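(* Let $p$ be an odd prime and let $G$ be a $p$-group of order $p^m$ of rank $4$. Then (1) $\displaystyle A_G(t/|G|)=\frac{1-p^{-1}}{1-p^{-2}t} + \frac{p^{-1}-p^{-3}}{1-p^{-1}t} + \frac{p^{-3}}{1-t}$; (2) $\displaystyle B_G(t/|G|)=\frac{-p^{-1}}{1-p^{-3}t} + \frac{1}{1-p^{-2}t} + \frac{p^{-1}}{1-p^{-1}t}$.
   Context: For a finite group $G$ and $n\ge 0$, $\alpha_{G,n}$ denotes the number of orbits of $G$ acting on $G^n$ by simultaneous conjugation $g\cdot(x_1,\dots,x_n)=(gx_1g^{-1},\dots,gx_ng^{-1})$, and $\beta_{G,n}$ denotes the number of orbits of the same action on the set $G^{(n)}$ of $n$-tuples of pairwise commuting elements of $G$; $\alpha_{G,0}=\beta_{G,0}=1$. Set $A_G(t)=\sum_{n\ge 0}\alpha_{G,n}t^n$ and $B_G(t)=\sum_{n\ge 0}\beta_{G,n}t^n$ (formal power series, which are rational functions of $t$). $A_G(t/|G|)$, $B_G(t/|G|)$ denote the result of substituting $t/|G|$ for $t$. Finite groups $G,H$ are isoclinic if there are isomorphisms $\theta:G/Z(G)\to H/Z(H)$ and $\phi:G'\to H'$ (derived subgroups) such that $\phi([g_1,g_2])=[h_1,h_2]$ whenever $\theta(g_iZ(G))=h_iZ(H)$ for $i=1,2$. Isoclinism is an equivalence relation, whose classes are called isoclinism families. For a $p$-group $G$, the rank of (the family of) $G$ is the smallest $r$ such that the isoclinism family of $G$ contains a group of order $p^r$; equivalently $p^r=|G/Z(G)|\,|Z(G)\cap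 G'|$. *)

theory Defs
  imports
    "HOL-Algebra.Generated_Groups"
    "HOL-Algebra.Group_Action"
    "HOL-Computational_Algebra.Formal_Power_Series"
    "HOL-Computational_Algebra.Primes"
begin

(* Elements of G^n are represented as lists of length n over the carrier. *)

definition tuples :: "('a, 'b) monoid_scheme \<Rightarrow> nat \<Rightarrow> 'a list set" where
  "tuples G n = {xs. length xs = n \<and> set xs \<subseteq> carrier G}"

definition commuting_tuples :: "('a, 'b) monoid_scheme \<Rightarrow> nat \<Rightarrow> 'a list set" where
  "commuting_tuples G n =
     {xs \<in> tuples G n. \<forall>i<n. \<forall>j<n. xs ! i \<otimes>\<^bsub>G\<^esub> xs ! j = xs ! j \<otimes>\<^bsub>G\<^esub> xs ! i}"

definition sim_conj :: "('a, 'b) monoid_scheme \<Rightarrow> 'a \<Rightarrow> 'a list \<Rightarrow> 'a list" where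
  "sim_conj G g xs = map (\<lambda>x. g \<otimes>\<^bsub>G\<^esub> x \<otimes>\<^bsub>G\<^esub> inv\<^bsub>G\<^esub> g) xs"

definition alpha :: "('a, 'b) monoid_scheme \<Rightarrow> nat \<Rightarrow> nat" where
  "alpha G n = card (orbits G (tuples G n) (sim_conj G))"

definition beta :: "('a, 'b) monoid_scheme \<Rightarrow> nat \<Rightarrow> nat" where
  "beta G n = card (orbits G (commuting_tuples G n) (sim_conj G))"

definition A_series :: "('a, 'b) monoid_scheme \<Rightarrow> rat fps" where
  "A_series G = Abs_fps (\<lambda>n. of_nat (alpha G n))"

definition B_series :: "('a, 'b) monoid_scheme \<Rightarrow> rat fps" where
  "B_series G = Abs_fps (\<lambda>n. of_nat (beta G n))"

definition center :: "('a, 'b) monoid_scheme \<Rightarrow> 'a set" where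
  "center G = {z \<in> carrier G. \<forall>g \<in> carrier G. z \<otimes>\<^bsub>G\<^esub> g = g \<otimes>\<^bsub>G\<^esub> z}"

definition commutator :: "('a, 'b) monoid_scheme \<Rightarrow> 'a \<Rightarrow> 'a \<Rightarrow> 'a" where
  "commutator G x y = x \<otimes>\<^bsub>G\<^esub> y \<otimes>\<^bsub>G\<^esub> inv\<^bsub>G\<^esub> x \<otimes>\<^bsub>G\<^esub> inv\<^bsub>G\<^esub> y"

definition derived_group :: "('a, 'b) monoid_scheme \<Rightarrow> ('a, 'b) monoid_scheme" where
  "derived_group G = G\<lparr>carrier := derived G (carrier G)\<rparr>"

(* G Mod N consists of the right cosets N #> g; as the center is normal, these
   are also the left cosets. *)

definition isoclinic :: "('a, 'c) monoid_scheme \<Rightarrow> ('b, 'd) monoid_scheme \<Rightarrow> bool" where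
  "isoclinic G H \<longleftrightarrow>
     (\<exists>\<theta> \<in> iso (G Mod center G) (H Mod center H).
      \<exists>\<phi> \<in> iso (derived_group G) (derived_group H).
        \<forall>g\<^sub>1 \<in> carrier G. \<forall>g\<^sub>2 \<in> carrier G. \<forall>h\<^sub>1 \<in> carrier H. \<forall>h\<^sub>2 \<in> carrier H.
          \<theta> (center G #>\<^bsub>G\<^esub> g\<^sub>1) = center H #>\<^bsub>H\<^esub> h\<^sub>1 \<longrightarrow>
          \<theta> (center G #>\<^bsub>G\<^esub> g\<^sub>2) = center H #>\<^bsub>H\<^esub> h\<^sub>2 \<longrightarrow>
          \<phi> (commutator G g\<^sub>1 g\<^sub>2) = commutator H h\<^sub>1 h\<^sub>2)"

(* Every finite group is isomorphic to one whose carrier is a set of natural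
   numbers, so letting H range over such groups covers the whole isoclinism family. *)

definition family_rank :: "nat \<Rightarrow> ('a, 'b) monoid_scheme \<Rightarrow> nat" where
  "family_rank p G =
     (LEAST r. \<exists>H :: nat monoid. group H \<and> order H = p ^ r \<and> isoclinic G H)"

definition geom :: "rat \<Rightarrow> rat \<Rightarrow> rat fps" where
  "geom c d = fps_const c / (1 - fps_const d * fps_X)"

end

theory Submission
  imports
    Defs
    "HOL-Algebra.Weak_Morphisms"
    "HOL-Algebra.Multiplicative_Group"
begin

text \<open>By Burnside's lemma, \<open>|G| \<alpha>\<^sub>n\<close> is the sum of the \<open>|C(g)|\<^sup>n\<close>, and \<open>|G| \<beta>\<^sub>n\<close> is the number of
  commuting \<open>(n+1)\<close>-tuples, which in turn is the sum over \<open>g\<close> of the number of commuting \<open>n\<close>-tuples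
  in \<open>C(g)\<close>. So only the centralizers matter. If \<open>|G/Z| \<le> p\<^sup>2\<close>, then \<open>G\<close> has class at most two and
  \<open>|G'| \<le> p\<close>, and Baer's construction on \<open>G/Z \<times> G'\<close> shows that the rank is at most three. Hence a group
  \<open>H\<close> of order \<open>p\<^sup>4\<close> in the family of \<open>G\<close> has \<open>|Z(H)| = p\<close>; the class equation of \<open>H\<close> modulo \<open>p\<^sup>2\<close> yields
  a noncentral element whose centralizer has index \<open>p\<close>, and this transfers to some \<open>x\<close> in \<open>G\<close>.
  Then \<open>A = C(x)\<close> is abelian, elements of \<open>A - Z\<close> have centralizer \<open>A\<close>, and every other noncentral
  element has an abelian centralizer of order \<open>p |Z|\<close>.\<close>

section \<open>Centralizers, orbits and commuting tuples\<close>

text \<open>The constants come from three class sizes. With z = |Z|, the orders of \<open>G\<close>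
  and A are p^3 z and p^2 z; the z central elements, the (p^2 - 1) z in A - Z and the (p^3 - p^2) z
  outside A have centralizers of relative order 1, 1/p and 1/p^2. The sizes divided by |G| are the
  coefficients in the first formula, the relative orders its ratios. For the second,
  \<open>G\<close> is the union of A and p^2 abelian subgroups of order p z, any two of all these
  meeting exactly in Z; the negative term corrects for the overlaps. The obstacle is that the rank
  is a minimum over existing groups. Rank 4 yields some group of order p^4, but a small central
  quotient can be excluded only by exhibiting a group of order at most p^3 in the family. Baer's
  construction does this, and there the oddness of p enters, since commutators must be halved. From
  H to \<open>G\<close> only the order of the central quotient and the index of the center in a
  centralizer are carried over; both are invariants of isoclinism.\<close>

definition centralizer :: "('a, 'b) monoid_scheme \<Rightarrow> 'a \<Rightarrow> 'a set" where
  "centralizer G x = {g \<in> carrier G. g \<otimes>\<^bsub>G\<^esub> x = x \<otimes>\<^bsub>G\<^esub> g}"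

context group
begin

lemma centralizer_subset: "centralizer G x \<subseteq> carrier G"
  by (auto simp: centralizer_def)

lemma mem_centralizer_commute:
  assumes "x \<in> carrier G" "y \<in> carrier G"
  shows "x \<in> centralizer G y \<longleftrightarrow> y \<in> centralizer G x"
  using assms by (auto simp: centralizer_def)

lemma centerI:
  assumes "z \<in> carrier G" "\<And>g. g \<in> carrier G \<Longrightarrow> z \<otimes> g = g \<otimes> z"
  shows "z \<in> center G"
  unfolding center_def using assms by blast

lemma center_commute:
  assumes "z \<in> center G" "g \<in> carrier G"
  shows "z \<otimes> g = g \<otimes> z"
  using assms unfolding center_def by blast

lemma center_subset: "center G \<subseteq> carrier G"
  unfolding center_def by blast

lemma center_iff_centralizer:
  assumes "z \<in> carrier G"
  shows "z \<in> center G \<longleftrightarrow> centralizer G z = carrier G"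
proof
  show "centralizer G z = carrier G" if "z \<in> center G"
    unfolding centralizer_def using center_commute[OF that] by auto
  show "z \<in> center G" if "centralizer G z = carrier G"
    using assms
  proof (rule centerI)
    fix g assume "g \<in> carrier G"
    then have "g \<in> centralizer G z"
      using that by simp
    then show "z \<otimes> g = g \<otimes> z"
      by (simp add: centralizer_def)
  qed
qed

lemma inv_commute:
  assumes "x \<in> carrier G" "y \<in> carrier G" "x \<otimes> y = y \<otimes> x"
  shows "inv x \<otimes> y = y \<otimes> inv x"
proof -
  have "x \<otimes> (y \<otimes> inv x) = y \<otimes> x \<otimes> inv x"
    using assms by (simp flip: m_assoc)
  also have "\<dots> = y"
    using assms(1,2) by (simp add: m_assoc)
  finally have "y = x \<otimes> (y \<otimes> inv x)" ..
  then show ?thesis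
    using assms inv_solve_left'[of "y \<otimes> inv x" x y] by simp
qed

lemma mult_commute_commute:
  assumes "x \<in> carrier G" "y \<in> carrier G" "z \<in> carrier G" "x \<otimes> z = z \<otimes> x" "y \<otimes> z = z \<otimes> y"
  shows "x \<otimes> y \<otimes> z = z \<otimes> (x \<otimes> y)"
proof -
  have "x \<otimes> y \<otimes> z = x \<otimes> z \<otimes> y"
    using assms(1-3,5) by (simp add: m_assoc)
  also have "\<dots> = z \<otimes> (x \<otimes> y)"
    unfolding assms(4) by (rule m_assoc[OF assms(3,1,2)])
  finally show ?thesis .
qed

lemma subgroup_centralizer:
  assumes "x \<in> carrier G"
  shows "subgroup (centralizer G x) G"
proof (rule subgroupI)
  show "centralizer G x \<noteq> {}"
    using assms by (auto simp: centralizer_def)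
  show "inv a \<in> centralizer G x" if "a \<in> centralizer G x" for a
    using that assms inv_commute by (auto simp: centralizer_def)
  show "a \<otimes> b \<in> centralizer G x" if "a \<in> centralizer G x" "b \<in> centralizer G x" for a b
    using that assms mult_commute_commute by (simp add: centralizer_def)
qed (rule centralizer_subset)

lemma center_subset_centralizer: "x \<in> carrier G \<Longrightarrow> center G \<subseteq> centralizer G x"
  unfolding center_def centralizer_def by blast

lemma subgroup_center: "subgroup (center G) G"
proof (rule subgroupI)
  have "\<one> \<in> center G"
    by (rule centerI) auto
  then show "center G \<noteq> {}"
    by blast
  show "inv a \<in> center G" if "a \<in> center G" for a
  proof (rule centerI)
    show "inv a \<otimes> g = g \<otimes> inv a" if "g \<in> carrier G" for g
      using inv_commute[OF _ _ center_commute] center_subset \<open>a \<in> center G\<close> that by blast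
  qed (use that center_subset in auto)
  show "a \<otimes> b \<in> center G" if "a \<in> center G" "b \<in> center G" for a b
  proof (rule centerI)
    show "a \<otimes> b \<otimes> g = g \<otimes> (a \<otimes> b)" if "g \<in> carrier G" for g
      using mult_commute_commute[OF _ _ _ center_commute center_commute] center_subset
        \<open>a \<in> center G\<close> \<open>b \<in> center G\<close> that by blast
  qed (use that center_subset in auto)
qed (rule center_subset)

lemma normal_center: "center G \<lhd> G"
proof (rule normal_invI[OF subgroup_center])
  fix x h assume x: "x \<in> carrier G" and h: "h \<in> center G"
  then have "x \<otimes> h = h \<otimes> x" "h \<in> carrier G"
    using center_commute center_subset by force+
  then have "x \<otimes> h \<otimes> inv x = h"
    using x by (simp add: m_assoc)
  then show "x \<otimes> h \<otimes> inv x \<in> center G"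
    using h by simp
qed

section \<open>Conjugation actions and Burnside's lemma\<close>

lemma conj_eq_iff:
  assumes "g \<in> carrier G" "x \<in> carrier G"
  shows "g \<otimes> x \<otimes> inv g = x \<longleftrightarrow> g \<otimes> x = x \<otimes> g"
  using assms inv_solve_right'[of x "g \<otimes> x" g] by simp

text \<open>\<open>BijGroup\<close> consists of extensional bijections, while
  \<open>sim_conj\<close> is defined on all lists; an action by such a function becomes a
  \<open>group_action\<close> only after restriction to \<open>E\<close>.\<close>

lemma group_action_restrict:
  assumes closed: "\<And>g x. g \<in> carrier G \<Longrightarrow> x \<in> E \<Longrightarrow> f g x \<in> E"
    and one: "\<And>x. x \<in> E \<Longrightarrow> f \<one> x = x"
    and mult: "\<And>g h x. g \<in> carrier G \<Longrightarrow> h \<in> carrier G \<Longrightarrow> x \<in> E \<Longrightarrow> f (g \<otimes> h) x = f g (f h x)"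
  shows "group_action G E (\<lambda>g. restrict (f g) E)"
proof -
  have "restrict (f g) E \<in> Bij E" if g: "g \<in> carrier G" for g
  proof -
    have "bij_betw (f g) E E"
    proof (rule bij_betwI[where g = "f (inv g)"])
      show "f (inv g) (f g x) = x" if "x \<in> E" for x
        using mult[of "inv g" g x] g that one by simp
      show "f g (f (inv g) x) = x" if "x \<in> E" for x
        using mult[of g "inv g" x] g that one by simp
    qed (use g closed in auto)
    then show ?thesis
      by (simp add: Bij_def bij_betw_restrict_eq)
  qed
  then have "(\<lambda>g. restrict (f g) E) \<in> hom G (BijGroup E)"
    unfolding hom_def BijGroup_def
    by (auto simp: compose_def mult closed intro!: restrict_ext)
  then have "group_hom G (BijGroup E) (\<lambda>g. restrict (f g) E)"
    by (simp add: group_hom_def group_hom_axioms_def group_BijGroup is_group)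
  then show ?thesis
    by (simp add: group_action_def)
qed

lemma orbits_restrict: "orbits G E (\<lambda>g. restrict (f g) E) = orbits G E f"
proof -
  have "orbit G (\<lambda>g. restrict (f g) E) x = orbit G f x" if "x \<in> E" for x
    using that by (simp add: orbit_def)
  then show ?thesis
    unfolding orbits_def by blast
qed

lemma burnside_restrict:
  assumes "finite (carrier G)" "finite E"
    and "\<And>g x. g \<in> carrier G \<Longrightarrow> x \<in> E \<Longrightarrow> f g x \<in> E"
    and "\<And>x. x \<in> E \<Longrightarrow> f \<one> x = x"
    and "\<And>g h x. g \<in> carrier G \<Longrightarrow> h \<in> carrier G \<Longrightarrow> x \<in> E \<Longrightarrow> f (g \<otimes> h) x = f g (f h x)"
  shows "card (orbits G E f) * order G = (\<Sum>g \<in> carrier G. card {x \<in> E. f g x = x})"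
proof -
  interpret group_action G E "\<lambda>g. restrict (f g) E"
    using assms(3-5) by (rule group_action_restrict)
  have "invariants E (\<lambda>g. restrict (f g) E) g = {x \<in> E. f g x = x}" for g
    by (auto simp: invariants_def)
  then show ?thesis
    using burnside[OF assms(1,2)] by (simp add: orbits_restrict)
qed

lemma conj_mult:
  assumes "g \<in> carrier G" "x \<in> carrier G" "y \<in> carrier G"
  shows "g \<otimes> (x \<otimes> y) \<otimes> inv g = (g \<otimes> x \<otimes> inv g) \<otimes> (g \<otimes> y \<otimes> inv g)"
proof -
  have "inv g \<otimes> (g \<otimes> (y \<otimes> inv g)) = y \<otimes> inv g"
    using assms by (simp flip: m_assoc)
  then show ?thesis
    using assms by (simp add: m_assoc)
qed

lemma conj_conj:
  assumes "g \<in> carrier G" "h \<in> carrier G" "x \<in> carrier G"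
  shows "(g \<otimes> h) \<otimes> x \<otimes> inv (g \<otimes> h) = g \<otimes> (h \<otimes> x \<otimes> inv h) \<otimes> inv g"
  using assms by (simp add: m_assoc inv_mult_group)

lemma finite_tuples: "finite (carrier G) \<Longrightarrow> finite (tuples G n)"
proof -
  have "tuples G n = {xs. set xs \<subseteq> carrier G \<and> length xs = n}"
    by (auto simp: tuples_def)
  then show "finite (carrier G) \<Longrightarrow> finite (tuples G n)"
    by (simp add: finite_lists_length_eq)
qed

text \<open>Commutation becomes a condition on the set of entries instead of on indices, which suits
  prepending an entry and conjugating all entries.\<close>

lemma mem_commuting_tuples:
  "xs \<in> commuting_tuples G n \<longleftrightarrow>
     length xs = n \<and> set xs \<subseteq> carrier G \<and> (\<forall>x \<in> set xs. \<forall>y \<in> set xs. x \<otimes> y = y \<otimes> x)"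
proof -
  have "(\<forall>x \<in> set xs. \<forall>y \<in> set xs. x \<otimes> y = y \<otimes> x) \<longleftrightarrow>
      (\<forall>i < length xs. \<forall>j < length xs. xs ! i \<otimes> xs ! j = xs ! j \<otimes> xs ! i)"
    by (simp only: all_set_conv_all_nth)
  then show ?thesis
    by (auto simp: commuting_tuples_def tuples_def)
qed

lemma sim_conj_fixed_iff:
  assumes "g \<in> carrier G" "set xs \<subseteq> carrier G"
  shows "sim_conj G g xs = xs \<longleftrightarrow> set xs \<subseteq> centralizer G g"
proof -
  have "sim_conj G g xs = xs \<longleftrightarrow> (\<forall>x \<in> set xs. g \<otimes> x \<otimes> inv g = x)"
    unfolding sim_conj_def using map_eq_conv[of _ xs "\<lambda>x. x"] by simp
  also have "\<dots> \<longleftrightarrow> (\<forall>x \<in> set xs. x \<in> centralizer G g)"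
  proof (intro ball_cong refl)
    fix x assume "x \<in> set xs"
    with assms have "x \<in> carrier G" by blast
    then show "g \<otimes> x \<otimes> inv g = x \<longleftrightarrow> x \<in> centralizer G g"
      using assms conj_eq_iff[of g x] by (auto simp: centralizer_def)
  qed
  finally show ?thesis
    by blast
qed

text \<open>One count serves both numbers: \<open>alpha\<close> takes all tuples for
  \<open>E\<close>, \<open>beta\<close> the commuting ones. A tuple is fixed by \<open>g\<close>
  exactly when its entries commute with \<open>g\<close>.\<close>

lemma sim_conj_burnside:
  assumes "finite (carrier G)" "E \<subseteq> tuples G n"
    and "\<And>g xs. g \<in> carrier G \<Longrightarrow> xs \<in> E \<Longrightarrow> sim_conj G g xs \<in> E"
  shows "card (orbits G E (sim_conj G)) * order G =
    (\<Sum>g \<in> carrier G. card {xs \<in> E. set xs \<subseteq> centralizer G g})"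
proof -
  have E: "set xs \<subseteq> carrier G" if "xs \<in> E" for xs
    using that assms(2) by (auto simp: tuples_def)
  have "card (orbits G E (sim_conj G)) * order G =
    (\<Sum>g \<in> carrier G. card {xs \<in> E. sim_conj G g xs = xs})"
  proof (rule burnside_restrict)
    show "finite E"
      using assms finite_tuples finite_subset by blast
    show "sim_conj G \<one> xs = xs" if "xs \<in> E" for xs
      unfolding sim_conj_def using E[OF that] by (intro map_idI) auto
    show "sim_conj G (g \<otimes> h) xs = sim_conj G g (sim_conj G h xs)"
      if "g \<in> carrier G" "h \<in> carrier G" "xs \<in> E" for g h xs
      using that E[OF that(3)] conj_conj by (auto simp: sim_conj_def)
  qed (use assms in auto)
  also have "\<dots> = (\<Sum>g \<in> carrier G. card {xs \<in> E. set xs \<subseteq> centralizer G g})"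
    using E sim_conj_fixed_iff by (intro sum.cong arg_cong[where f = card]) auto
  finally show ?thesis .
qed

lemma alpha_times_order:
  assumes "finite (carrier G)"
  shows "alpha G n * order G = (\<Sum>g \<in> carrier G. card (centralizer G g) ^ n)"
proof -
  have "alpha G n * order G =
      (\<Sum>g \<in> carrier G. card {xs \<in> tuples G n. set xs \<subseteq> centralizer G g})"
    unfolding alpha_def
    by (rule sim_conj_burnside[OF assms subset_refl]) (auto simp: tuples_def sim_conj_def)
  also have "\<dots> = (\<Sum>g \<in> carrier G. card (centralizer G g) ^ n)"
  proof (rule sum.cong[OF refl])
    fix g
    have "{xs \<in> tuples G n. set xs \<subseteq> centralizer G g} =
        {xs. set xs \<subseteq> centralizer G g \<and> length xs = n}"
      using centralizer_subset by (auto simp: tuples_def)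
    then show "card {xs \<in> tuples G n. set xs \<subseteq> centralizer G g} = card (centralizer G g) ^ n"
      using card_lists_length_eq[OF finite_subset[OF centralizer_subset assms]] by simp
  qed
  finally show ?thesis .
qed

text \<open>Splitting off the first entry \<open>g\<close> leaves a commuting tuple with entries in
  the centralizer of \<open>g\<close>.\<close>

lemma card_commuting_tuples_Suc:
  assumes "finite (carrier G)"
  shows "card (commuting_tuples G (Suc n)) =
    (\<Sum>g \<in> carrier G. card {xs \<in> commuting_tuples G n. set xs \<subseteq> centralizer G g})"
proof -
  let ?S = "\<lambda>g. {xs \<in> commuting_tuples G n. set xs \<subseteq> centralizer G g}"
  have "commuting_tuples G (Suc n) = (\<lambda>(g, xs). g # xs) ` (SIGMA g : carrier G. ?S g)"
  proof (intro equalityI subsetI)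
    fix ys assume ys: "ys \<in> commuting_tuples G (Suc n)"
    then obtain g xs where "ys = g # xs"
      by (auto simp: mem_commuting_tuples length_Suc_conv)
    with ys show "ys \<in> (\<lambda>(g, xs). g # xs) ` (SIGMA g : carrier G. ?S g)"
      by (auto simp: mem_commuting_tuples centralizer_def)
  next
    fix ys assume "ys \<in> (\<lambda>(g, xs). g # xs) ` (SIGMA g : carrier G. ?S g)"
    then show "ys \<in> commuting_tuples G (Suc n)"
      by (auto simp: mem_commuting_tuples centralizer_def subset_iff)
  qed
  moreover have "inj_on (\<lambda>(g, xs). g # xs) (SIGMA g : carrier G. ?S g)"
    by (auto simp: inj_on_def)
  moreover have "finite (?S g)" for g
    using finite_tuples[OF assms, of n] by (auto simp: commuting_tuples_def)
  ultimately show ?thesis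
    using assms by (simp add: card_image)
qed

lemma card_commuting_tuples_abelian:
  assumes "finite C" "C \<subseteq> carrier G" "\<And>u v. u \<in> C \<Longrightarrow> v \<in> C \<Longrightarrow> u \<otimes> v = v \<otimes> u"
  shows "card {xs \<in> commuting_tuples G n. set xs \<subseteq> C} = card C ^ n"
proof -
  have "{xs \<in> commuting_tuples G n. set xs \<subseteq> C} = {xs. set xs \<subseteq> C \<and> length xs = n}"
    unfolding mem_commuting_tuples using assms(2,3) by blast
  then show ?thesis
    using card_lists_length_eq[OF assms(1)] by simp
qed

text \<open>A commuting \<open>n\<close>-tuple fixed by \<open>g\<close> becomes, with
  \<open>g\<close> prepended, a commuting tuple of length \<open>n + 1\<close>; the Burnside sum
  counts exactly these.\<close>

lemma beta_times_order:
  assumes "finite (carrier G)"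
  shows "beta G n * order G = card (commuting_tuples G (Suc n))"
  unfolding beta_def card_commuting_tuples_Suc[OF assms]
proof (rule sim_conj_burnside[OF assms])
  show "commuting_tuples G n \<subseteq> tuples G n"
    by (auto simp: commuting_tuples_def)
  show "sim_conj G g xs \<in> commuting_tuples G n"
    if g: "g \<in> carrier G" and xs: "xs \<in> commuting_tuples G n" for g xs
    unfolding mem_commuting_tuples sim_conj_def
  proof (intro conjI ballI)
    fix u v assume "u \<in> set (map (\<lambda>x. g \<otimes> x \<otimes> inv g) xs)" "v \<in> set (map (\<lambda>x. g \<otimes> x \<otimes> inv g) xs)"
    then obtain x y where x: "x \<in> set xs" "u = g \<otimes> x \<otimes> inv g"
      and y: "y \<in> set xs" "v = g \<otimes> y \<otimes> inv g"
      by auto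
    then have "x \<otimes> y = y \<otimes> x" "x \<in> carrier G" "y \<in> carrier G"
      using xs by (auto simp: mem_commuting_tuples)
    then show "u \<otimes> v = v \<otimes> u"
      using x y g conj_mult by metis
  qed (use g xs in \<open>auto simp: mem_commuting_tuples\<close>)
qed

text \<open>The class equation as a divisibility statement: the class of a noncentral
  \<open>x\<close> has the index of its centralizer as size, and \<open>d\<close> divides each of
  these indices. It is applied with p and with p^2.\<close>

lemma dvd_card_noncentral:
  assumes fin: "finite (carrier G)"
    and d: "\<And>x. x \<in> carrier G - center G \<Longrightarrow> d * card (centralizer G x) dvd order G"
  shows "d dvd card (carrier G - center G)"
proof -
  define E where "E = carrier G - center G"
  let ?f = "\<lambda>g x. g \<otimes> x \<otimes> inv g"
  have action: "group_action G E (\<lambda>g. restrict (?f g) E)"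
  proof (rule group_action_restrict[where f = ?f])
    fix g x assume g: "g \<in> carrier G" and x: "x \<in> E"
    have "x \<in> center G" if "?f g x \<in> center G"
    proof -
      have "inv g \<otimes> ?f g x \<otimes> inv (inv g) \<in> center G"
        by (rule normal.inv_op_closed2[OF normal_center inv_closed[OF g] that])
      moreover have "inv g \<otimes> ?f g x \<otimes> inv (inv g) = x"
        using g x conj_conj[of "inv g" g x] by (simp add: E_def)
      ultimately show ?thesis by simp
    qed
    then show "?f g x \<in> E"
      using g x by (auto simp: E_def)
  next
    show "?f \<one> x = x" if "x \<in> E" for x
      using that by (simp add: E_def)
    show "?f (g \<otimes> h) x = ?f g (?f h x)" if "g \<in> carrier G" "h \<in> carrier G" "x \<in> E" for g h x
      using that by (intro conj_conj) (auto simp: E_def)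
  qed
  interpret act: group_action G E "\<lambda>g. restrict (?f g) E"
    by (rule action)
  have "d dvd card B" if "B \<in> orbits G E (\<lambda>g. restrict (?f g) E)" for B
  proof -
    from that obtain x where x: "x \<in> E" and B: "B = orbit G (\<lambda>g. restrict (?f g) E) x"
      by (auto simp: orbits_def)
    have "stabilizer G (\<lambda>g. restrict (?f g) E) x = centralizer G x"
      using x conj_eq_iff by (auto simp: stabilizer_def centralizer_def E_def)
    then have "card B * card (centralizer G x) = order G"
      using act.orbit_stabilizer_theorem[OF x] B by simp
    moreover have "d * card (centralizer G x) dvd order G"
      using d x by (simp add: E_def)
    ultimately have "d * card (centralizer G x) dvd card B * card (centralizer G x)"
      by simp
    moreover have "card (centralizer G x) \<noteq> 0"
      using x fin by (auto simp: E_def centralizer_def)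
    ultimately show ?thesis
      using dvd_times_right_cancel_iff by blast
  qed
  then have "d dvd (\<Sum>B\<in>orbits G E (\<lambda>g. restrict (?f g) E). card B)"
    by (rule dvd_sum)
  moreover have "finite E"
    using fin by (simp add: E_def)
  then have "(\<Sum>B\<in>orbits G E (\<lambda>g. restrict (?f g) E). \<Sum>x\<in>B. 1) = (\<Sum>x\<in>E. 1::nat)"
    by (rule act.disjoint_sum)
  ultimately show ?thesis
    unfolding E_def by simp
qed

end

section \<open>Groups of prime power order\<close>

text \<open>If a coset of \<open>A\<close> contains some \<open>c\<close> of \<open>C\<close>, right
  translation by \<open>inv c\<close> moves its part in \<open>C\<close> injectively into
  \<open>A \<inter> C\<close>. This bounds centralizers of elements outside a subgroup of index
  p.\<close>

lemma (in group) card_subgroup_le_cosets: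
  assumes "finite (carrier G)" "subgroup A G" "subgroup C G"
  shows "card C \<le> card (rcosets A) * card (A \<inter> C)"
proof -
  have fin: "finite A" "finite C"
    using assms finite_subset subgroup.subset by blast+
  have bound: "card (C \<inter> R) \<le> card (A \<inter> C)" if R: "R \<in> rcosets A" for R
  proof (cases "C \<inter> R = {}")
    case False
    then obtain c where c: "c \<in> C" "c \<in> R" by blast
    have carr: "x \<in> carrier G" if "x \<in> C" for x
      using that assms(3) subgroup.subset by blast
    show ?thesis
    proof (rule card_inj_on_le)
      show "inj_on (\<lambda>x. x \<otimes> inv c) (C \<inter> R)"
        using carr c by (auto simp: inj_on_def)
      show "(\<lambda>x. x \<otimes> inv c) ` (C \<inter> R) \<subseteq> A \<inter> C"
      proof (intro image_subsetI IntI)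
        fix x assume x: "x \<in> C \<inter> R"
        then show "x \<otimes> inv c \<in> A"
          using diff_neutralizes[OF assms(2) R] c by blast
        show "x \<otimes> inv c \<in> C"
          using x c assms(3) subgroupE(3,4) by blast
      qed
    qed (use fin in blast)
  qed simp
  have "finite (rcosets A)"
    by (metis assms(1,2) finite_UnionD rcosets_part_G)
  moreover have "C = (\<Union>R \<in> rcosets A. C \<inter> R)"
    using rcosets_part_G[OF assms(2)] subgroup.subset[OF assms(3)] by blast
  ultimately have "card C \<le> (\<Sum>R \<in> rcosets A. card (C \<inter> R))"
    using card_UN_le[of "rcosets A" "\<lambda>R. C \<inter> R"] by simp
  also have "\<dots> \<le> card (rcosets A) * card (A \<inter> C)"
    using sum_bounded_above[of "rcosets A" "\<lambda>R. card (C \<inter> R)"] bound by simp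
  finally show ?thesis .
qed

locale prime_power_group = group +
  fixes p m :: nat
  assumes prime_p: "prime p"
    and order_eq: "order G = p ^ m"
begin

lemma p_pos: "p > 0" and p_gt_1: "p > 1"
  using prime_p prime_gt_0_nat prime_gt_1_nat by auto

lemma finite_carrier: "finite (carrier G)"
  using order_eq p_pos by (simp flip: order_gt_0_iff_finite)

lemma finite_subgroup: "subgroup H G \<Longrightarrow> finite H"
  using finite_carrier finite_subset subgroup.subset by blast

lemma card_subgroup:
  assumes "subgroup H G"
  obtains i where "i \<le> m" "card H = p ^ i"
proof -
  have "card H dvd p ^ m"
    using lagrange[OF assms] order_eq by (metis dvd_triv_right)
  then show ?thesis
    using that prime_p divides_primepow_nat by blast
qed

text \<open>Both orders are powers of p by Lagrange, so a proper inclusion raises the exponent by at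
  least one.\<close>

lemma card_psubset_subgroup:
  assumes "subgroup H G" "subgroup K G" "H \<subset> K"
  shows "p * card H dvd card K"
proof -
  obtain i j where i: "card H = p ^ i" and j: "card K = p ^ j"
    using card_subgroup assms by metis
  have "card H < card K"
    using assms finite_subgroup by (intro psubset_card_mono)
  then have "Suc i \<le> j"
    using i j p_gt_1 by (simp add: Suc_le_eq)
  then have "p ^ Suc i dvd p ^ j"
    by (rule le_imp_power_dvd)
  then show ?thesis
    using i j by simp
qed

text \<open>This plays the role of "cyclic central quotient implies abelian". If \<open>u\<close>
  lies outside \<open>D\<close>, its centralizer in \<open>S\<close> contains \<open>D\<close> and
  \<open>u\<close>, so it has order at least p |D| and is all of \<open>S\<close>.\<close>

lemma commute_of_central_index_le:
  assumes D: "subgroup D G" and S: "subgroup S G" and "D \<subseteq> S"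
    and index: "card S \<le> p * card D"
    and central: "\<And>d s. d \<in> D \<Longrightarrow> s \<in> S \<Longrightarrow> d \<otimes> s = s \<otimes> d"
    and u: "u \<in> S" and v: "v \<in> S"
  shows "u \<otimes> v = v \<otimes> u"
proof (cases "u \<in> D")
  case False
  have uG: "u \<in> carrier G" and SG: "S \<subseteq> carrier G"
    using u S subgroup.subset by blast+
  have K: "subgroup (S \<inter> centralizer G u) G"
    using S subgroup_centralizer[OF uG] by (rule subgroups_Inter_pair)
  have "D \<subseteq> S \<inter> centralizer G u"
    using \<open>D \<subseteq> S\<close> SG central u unfolding centralizer_def by blast
  moreover have "u \<in> S \<inter> centralizer G u"
    using u uG by (simp add: centralizer_def)
  ultimately have "D \<subset> S \<inter> centralizer G u"
    using False by blast
  then have "p * card D dvd card (S \<inter> centralizer G u)"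
    using D K card_psubset_subgroup by blast
  moreover have "card (S \<inter> centralizer G u) > 0"
    using \<open>u \<in> S \<inter> centralizer G u\<close> finite_subgroup[OF K] card_gt_0_iff by blast
  ultimately have "card S \<le> card (S \<inter> centralizer G u)"
    using index dvd_imp_le le_trans by blast
  then have "S \<inter> centralizer G u = S"
    using finite_subgroup[OF S] by (intro card_seteq) auto
  then have "v \<in> centralizer G u"
    using v by blast
  then show ?thesis
    by (simp add: centralizer_def)
next
  case True
  then show ?thesis
    using v by (rule central)
qed

lemma center_eq_carrier:
  assumes "order G \<le> p * card (center G)"
  shows "center G = carrier G"
proof (intro equalityI subsetI)
  fix u assume u: "u \<in> carrier G"
  show "u \<in> center G"
    using u
  proof (rule centerI)
    fix v assume v: "v \<in> carrier G"
    show "u \<otimes> v = v \<otimes> u"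
      by (rule commute_of_central_index_le[OF subgroup_center subgroup_self center_subset
            assms[unfolded order_def] _ u v]) (rule center_commute)
  qed
qed (use center_subset in blast)

lemma centralizer_psubset:
  assumes "x \<in> carrier G - center G"
  shows "center G \<subset> centralizer G x" "centralizer G x \<subset> carrier G"
proof -
  have "x \<in> centralizer G x"
    using assms by (simp add: centralizer_def)
  then show "center G \<subset> centralizer G x"
    using assms center_subset_centralizer by blast
  show "centralizer G x \<subset> carrier G"
    using assms centralizer_subset center_iff_centralizer by blast
qed

lemma order_split: "order G = card (center G) + card (carrier G - center G)"
  using card_Un_disjoint[of "center G" "carrier G - center G"] finite_carrier
    finite_subgroup[OF subgroup_center] center_subset
  by (simp add: order_def Un_absorb1)

lemma p_dvd_card_center:
  assumes "m > 0"
  shows "p dvd card (center G)"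
proof -
  have "p dvd card (carrier G - center G)"
  proof (rule dvd_card_noncentral[OF finite_carrier])
    fix x assume x: "x \<in> carrier G - center G"
    then have "subgroup (centralizer G x) G"
      using subgroup_centralizer by blast
    from card_psubset_subgroup[OF this subgroup_self centralizer_psubset(2)[OF x]]
    show "p * card (centralizer G x) dvd order G"
      unfolding order_def .
  qed
  moreover have "p dvd card (center G) + card (carrier G - center G)"
    using assms unfolding order_split[symmetric] order_eq by (intro dvd_power) simp
  ultimately show ?thesis
    using dvd_add_left_iff by blast
qed

text \<open>Otherwise every noncentral centralizer has an order strictly between p and p^4 and
  different from p^3, hence p^2. All noncentral classes then have size p^2, and p^2 would divide |Z|
  = p.\<close>

lemma exists_large_centralizer:
  assumes "m = 4" "card (center G) = p"
  shows "\<exists>x \<in> carrier G - center G. card (centralizer G x) = p ^ 3"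
proof (rule ccontr)
  assume neg: "\<not> ?thesis"
  have "p ^ 2 dvd card (carrier G - center G)"
  proof (rule dvd_card_noncentral[OF finite_carrier])
    fix x assume x: "x \<in> carrier G - center G"
    then have C: "subgroup (centralizer G x) G"
      using subgroup_centralizer by blast
    then obtain i where i: "card (centralizer G x) = p ^ i"
      using card_subgroup by blast
    have "p < p ^ i"
      using x centralizer_psubset(1) finite_subgroup[OF C] i assms(2) psubset_card_mono by metis
    then have "i > 1"
      using p_gt_1 power_strict_increasing_iff[of p 1 i] by simp
    moreover have "p ^ i < p ^ 4"
      using x centralizer_psubset(2) finite_carrier i order_eq assms(1) psubset_card_mono
      unfolding order_def by metis
    then have "i < 4"
      using p_gt_1 by simp
    moreover have "i \<noteq> 3"
      using neg x i by blast
    ultimately have "i = 2" by simp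
    then show "p ^ 2 * card (centralizer G x) dvd order G"
      using i order_eq assms(1) by (simp flip: power_add)
  qed
  moreover have "p ^ 2 dvd card (center G) + card (carrier G - center G)"
    unfolding order_split[symmetric] order_eq assms(1) by (rule le_imp_power_dvd) simp
  ultimately have "p ^ 2 dvd card (center G)"
    using dvd_add_left_iff by blast
  then have "p ^ 2 dvd p"
    unfolding assms(2) .
  then show False
    using p_gt_1 by (simp add: power2_eq_square)
qed

end

text \<open>The commutation structure shared by all groups isoclinic to a group of order \<open>p\<^sup>4\<close> and
  maximal class.\<close>

locale large_centralizer = prime_power_group +
  fixes x :: 'a
  assumes center_index: "order G = p ^ 3 * card (center G)"
    and noncentral: "x \<in> carrier G - center G"
    and centralizer_index: "order G = p * card (centralizer G x)"
begin

abbreviation "A \<equiv> centralizer G x"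
abbreviation "z \<equiv> card (center G)"

lemma z_pos: "z > 0"
  using center_index order_gt_0_iff_finite finite_carrier by (metis gr0I mult_0_right less_irrefl)

lemma subgroup_A: "subgroup A G"
  using noncentral subgroup_centralizer by blast

lemma card_A: "card A = p ^ 2 * z"
proof -
  have "p * card A = p * (p ^ 2 * z)"
    using center_index centralizer_index
    by (simp only: power2_eq_square power3_eq_cube mult.assoc)
  then show ?thesis
    using p_pos by (metis mult_cancel1 not_gr_zero)
qed

text \<open>The center \<open>D\<close> of \<open>A\<close> contains Z and also \<open>x\<close>,
  which is not central in \<open>G\<close>. Hence \<open>D\<close> has order at least p z, so index
  at most p in \<open>A\<close>, and a central subgroup of such index forces commutativity.\<close>

lemma A_commute:
  assumes "u \<in> A" "v \<in> A"
  shows "u \<otimes> v = v \<otimes> u"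
proof -
  let ?GA = "G\<lparr>carrier := A\<rparr>"
  define D where "D = center ?GA"
  have D_def': "D = {d \<in> A. \<forall>s \<in> A. d \<otimes> s = s \<otimes> d}"
    by (simp add: D_def center_def)
  have "group ?GA"
    using subgroup_A subgroup_imp_group by blast
  then have D: "subgroup D G"
    unfolding D_def using incl_subgroup[OF subgroup_A] group.subgroup_center by blast
  have "center G \<subseteq> A"
    using noncentral center_subset_centralizer by blast
  then have "center G \<subseteq> D"
    unfolding D_def' using center_commute centralizer_subset by blast
  moreover have "x \<in> D"
    unfolding D_def' using noncentral by (auto simp: centralizer_def)
  ultimately have "center G \<subset> D"
    using noncentral by blast
  then have "p * z dvd card D"
    using card_psubset_subgroup[OF subgroup_center D] by blast
  moreover have "card D > 0"
    using \<open>x \<in> D\<close> finite_subgroup[OF D] card_gt_0_iff by blast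
  ultimately have "p * z \<le> card D"
    using dvd_imp_le by blast
  then have "card A \<le> p * card D"
    unfolding card_A power2_eq_square mult.assoc by simp
  moreover have "D \<subseteq> A" "\<And>d s. d \<in> D \<Longrightarrow> s \<in> A \<Longrightarrow> d \<otimes> s = s \<otimes> d"
    unfolding D_def' by blast+
  ultimately show ?thesis
    using commute_of_central_index_le[OF D subgroup_A] assms by blast
qed

text \<open>As \<open>A\<close> is abelian, it lies in the centralizer of \<open>a\<close>. Since
  \<open>A\<close> has index p, a properly larger centralizer would be all of \<open>G\<close>, and
  \<open>a\<close> would be central.\<close>

lemma centralizer_inside:
  assumes a: "a \<in> A - center G"
  shows "centralizer G a = A"
proof (rule ccontr)
  assume "centralizer G a \<noteq> A"
  have aG: "a \<in> carrier G - center G"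
    using a centralizer_subset by blast
  have "A \<subseteq> centralizer G a"
    using a A_commute centralizer_subset unfolding centralizer_def[of G a] by blast
  then have "A \<subset> centralizer G a"
    using \<open>centralizer G a \<noteq> A\<close> by blast
  moreover have C: "subgroup (centralizer G a) G"
    using aG subgroup_centralizer by blast
  ultimately have "order G dvd card (centralizer G a)"
    using card_psubset_subgroup[OF subgroup_A] centralizer_index by metis
  moreover have "card (centralizer G a) > 0"
    using finite_subgroup[OF C] subgroup.one_closed[OF C] card_gt_0_iff by blast
  ultimately have "order G \<le> card (centralizer G a)"
    using dvd_imp_le by blast
  moreover have "card (centralizer G a) < order G"
    unfolding order_def using centralizer_psubset(2)[OF aG] finite_carrier psubset_card_mono by blast
  ultimately show False by simp
qed

text \<open>A noncentral \<open>a\<close> in \<open>A\<close> commuting with \<open>y\<close> would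
  have centralizer \<open>A\<close>, which misses \<open>y\<close>; so the centralizer of
  \<open>y\<close> meets \<open>A\<close> exactly in Z. As \<open>A\<close> has index p, its order
  is at most p z, and at least p z because \<open>y\<close> is noncentral. Then Z is central of
  index p in it.\<close>

lemma centralizer_outside:
  assumes y: "y \<in> carrier G - A"
  shows "card (centralizer G y) = p * z"
    and "\<And>u v. u \<in> centralizer G y \<Longrightarrow> v \<in> centralizer G y \<Longrightarrow> u \<otimes> v = v \<otimes> u"
proof -
  have yG: "y \<in> carrier G - center G"
    using y noncentral center_subset_centralizer by blast
  have C: "subgroup (centralizer G y) G"
    using yG subgroup_centralizer by blast
  have "A \<inter> centralizer G y \<subseteq> center G"
  proof
    fix a assume a: "a \<in> A \<inter> centralizer G y"
    then have "y \<in> centralizer G a"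
      using y mem_centralizer_commute centralizer_subset by blast
    then show "a \<in> center G"
      using a y centralizer_inside by blast
  qed
  then have "A \<inter> centralizer G y = center G"
    using yG noncentral center_subset_centralizer by blast
  moreover have "p * card A = card (rcosets A) * card A"
    unfolding lagrange[OF subgroup_A] by (rule centralizer_index[symmetric])
  then have "card (rcosets A) = p"
    using card_A p_pos z_pos by (metis mult_cancel2 mult_is_0 not_gr_zero power_eq_0_iff)
  ultimately have le: "card (centralizer G y) \<le> p * z"
    using card_subgroup_le_cosets[OF finite_carrier subgroup_A C] by simp
  have "p * z dvd card (centralizer G y)"
    using card_psubset_subgroup[OF subgroup_center C] centralizer_psubset(1)[OF yG] by blast
  moreover have "card (centralizer G y) > 0"
    using finite_subgroup[OF C] subgroup.one_closed[OF C] card_gt_0_iff by blast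
  ultimately show "card (centralizer G y) = p * z"
    using le dvd_imp_le le_antisym by blast
  show "u \<otimes> v = v \<otimes> u" if "u \<in> centralizer G y" "v \<in> centralizer G y" for u v
    by (rule commute_of_central_index_le[OF subgroup_center C])
      (use le that yG center_subset_centralizer center_commute centralizer_subset in blast)+
qed

text \<open>The three kinds of elements number z, (p^2 - 1) z and (p^3 - p^2) z. Rational values
  keep these differences from being truncated.\<close>

lemma sum_by_type:
  fixes F :: "'a \<Rightarrow> rat"
  assumes "\<And>g. g \<in> center G \<Longrightarrow> F g = a" "\<And>g. g \<in> A - center G \<Longrightarrow> F g = b"
    "\<And>g. g \<in> carrier G - A \<Longrightarrow> F g = c"
  shows "(\<Sum>g \<in> carrier G. F g) = of_nat z * (a + (of_nat p ^ 2 - 1) * b + (of_nat p ^ 3 - of_nat p ^ 2) * c)"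
proof -
  have sub: "center G \<subseteq> A" "A \<subseteq> carrier G"
    using noncentral center_subset_centralizer centralizer_subset by auto
  have fin: "finite A" "finite (center G)"
    using finite_subgroup subgroup_A subgroup_center by auto
  have "(\<Sum>g \<in> carrier G. F g) = (\<Sum>g \<in> carrier G - A. F g) + (\<Sum>g \<in> A. F g)"
    using sub(2) finite_carrier by (rule sum.subset_diff)
  also have "(\<Sum>g \<in> A. F g) = (\<Sum>g \<in> A - center G. F g) + (\<Sum>g \<in> center G. F g)"
    using sub(1) fin(1) by (rule sum.subset_diff)
  also have "(\<Sum>g \<in> carrier G - A. F g) = of_nat (card (carrier G - A)) * c"
    using assms(3) by simp
  also have "(\<Sum>g \<in> A - center G. F g) = of_nat (card (A - center G)) * b"
    using assms(2) by simp
  also have "(\<Sum>g \<in> center G. F g) = of_nat z * a"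
    using assms(1) by simp
  also have "of_nat (card (carrier G - A)) = (of_nat (p ^ 3 * z) - of_nat (p ^ 2 * z) :: rat)"
    using sub fin finite_carrier card_A center_index card_mono[OF finite_carrier sub(2)]
    by (simp add: card_Diff_subset of_nat_diff order_def)
  also have "of_nat (card (A - center G)) = (of_nat (p ^ 2 * z) - of_nat z :: rat)"
    using sub fin card_A card_mono[OF fin(1) sub(1)] by (simp add: card_Diff_subset of_nat_diff)
  finally show ?thesis
    by (simp add: algebra_simps)
qed

text \<open>The factor |G|^n is pulled out because substituting t/|G| will cancel it. The Burnside
  count is divided by z alone, so of |G| = p^3 z the factor p^3 stays on the left.\<close>

lemma alpha_eq:
  "of_nat (alpha G n) * of_nat p ^ 3 =
    of_nat (order G) ^ n * (1 + (of_nat p ^ 2 - 1) / of_nat p ^ n + (of_nat p ^ 3 - of_nat p ^ 2) / (of_nat p ^ 2) ^ n :: rat)"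
proof -
  let ?p = "of_nat p :: rat" and ?z = "of_nat z :: rat"
  have p: "?p \<noteq> 0" and z: "?z \<noteq> 0"
    using p_pos z_pos by auto
  have "?z * (of_nat (alpha G n) * ?p ^ 3) = of_nat (alpha G n * order G)"
    using center_index by simp
  also have "\<dots> = (\<Sum>g \<in> carrier G. of_nat (card (centralizer G g) ^ n))"
    using alpha_times_order[OF finite_carrier] by simp
  also have "\<dots> = ?z * (of_nat (order G) ^ n + (?p ^ 2 - 1) * (?p ^ 2 * ?z) ^ n
      + (?p ^ 3 - ?p ^ 2) * (?p * ?z) ^ n)"
  proof (rule sum_by_type)
    show "of_nat (card (centralizer G g) ^ n) = of_nat (order G) ^ n" if "g \<in> center G" for g
      using that center_iff_centralizer center_subset by (auto simp: order_def)
    show "of_nat (card (centralizer G g) ^ n) = (?p ^ 2 * ?z) ^ n" if "g \<in> A - center G" for g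
      using centralizer_inside[OF that] card_A by simp
    show "of_nat (card (centralizer G g) ^ n) = (?p * ?z) ^ n" if "g \<in> carrier G - A" for g
      using centralizer_outside(1)[OF that] by simp
  qed
  also have "of_nat (order G) = ?p * (?p ^ 2 * ?z)"
    using center_index by (simp add: power2_eq_square power3_eq_cube)
  finally have "of_nat (alpha G n) * ?p ^ 3 = (?p * (?p ^ 2 * ?z)) ^ n + (?p ^ 2 - 1) * (?p ^ 2 * ?z) ^ n
      + (?p ^ 3 - ?p ^ 2) * (?p * ?z) ^ n"
    using z by simp
  also have "\<dots> = (?p * (?p ^ 2 * ?z)) ^ n * (1 + (?p ^ 2 - 1) / ?p ^ n + (?p ^ 3 - ?p ^ 2) / (?p ^ 2) ^ n)"
    using p by (simp add: power_mult_distrib field_simps)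
  finally show ?thesis
    using center_index by (simp add: power2_eq_square power3_eq_cube mult.assoc)
qed

text \<open>A commuting tuple lies in \<open>A\<close> or in the centralizer of some element outside
  \<open>A\<close>. Each such centralizer has (p - 1) z noncentral elements, and these sets
  partition the complement of \<open>A\<close>, so there are p^2 of them. Subtracting
  \<open>of_nat z ^ n\<close> avoids counting central tuples again.\<close>

lemma card_commuting_tuples:
  "of_nat (card (commuting_tuples G n)) =
    ((of_nat p ^ 2 * of_nat z) ^ n + of_nat p ^ 2 * ((of_nat p * of_nat z) ^ n - of_nat z ^ n) :: rat)"
proof (induction n)
  case 0
  have "commuting_tuples G 0 = {[]}"
    by (auto simp: mem_commuting_tuples)
  then show ?case by simp
next
  case (Suc n)
  let ?p = "of_nat p :: rat" and ?z = "of_nat z :: rat"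
  have "of_nat (card (commuting_tuples G (Suc n))) =
      (\<Sum>g \<in> carrier G. of_nat (card {xs \<in> commuting_tuples G n. set xs \<subseteq> centralizer G g}) :: rat)"
    using card_commuting_tuples_Suc[OF finite_carrier] by simp
  also have "\<dots> = ?z * (of_nat (card (commuting_tuples G n)) + (?p ^ 2 - 1) * (?p ^ 2 * ?z) ^ n
      + (?p ^ 3 - ?p ^ 2) * (?p * ?z) ^ n)"
  proof (rule sum_by_type)
    fix g
    show "of_nat (card {xs \<in> commuting_tuples G n. set xs \<subseteq> centralizer G g})
        = (of_nat (card (commuting_tuples G n)) :: rat)" if "g \<in> center G"
    proof -
      have "centralizer G g = carrier G"
        using that center_iff_centralizer center_subset by blast
      then have "{xs \<in> commuting_tuples G n. set xs \<subseteq> centralizer G g} = commuting_tuples G n"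
        using mem_commuting_tuples by blast
      then show ?thesis by simp
    qed
    show "of_nat (card {xs \<in> commuting_tuples G n. set xs \<subseteq> centralizer G g}) = (?p ^ 2 * ?z) ^ n"
      if "g \<in> A - center G"
      unfolding centralizer_inside[OF that]
      using card_commuting_tuples_abelian[OF finite_subgroup[OF subgroup_A] centralizer_subset A_commute]
        card_A by simp
    show "of_nat (card {xs \<in> commuting_tuples G n. set xs \<subseteq> centralizer G g}) = (?p * ?z) ^ n"
      if "g \<in> carrier G - A"
    proof -
      have "finite (centralizer G g)"
        using that finite_carrier finite_subset centralizer_subset by blast
      from card_commuting_tuples_abelian[OF this centralizer_subset centralizer_outside(2)[OF that]]
      show ?thesis
        unfolding centralizer_outside(1)[OF that] by simp
    qed
  qed
  \<comment> \<open>The coefficients z and (p^2 - 1) z of (p^2 z)^n add up to p^2 z; those of (p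
    z)^n, namely p^2 z and (p^3 - p^2) z, add up to p^3 z = p^2 (p z).\<close>
  finally show ?case
    unfolding Suc by (simp add: algebra_simps power2_eq_square power3_eq_cube)
qed

text \<open>The number of commuting tuples of length \<open>Suc n\<close> is divided by |G| = p^3 z:
  the surplus factors p^2 z, p^2 (p z) and p^2 z become 1/p, 1 and 1/p, and one p is
  cleared.\<close>

lemma beta_eq:
  "of_nat (beta G n) * of_nat p =
    of_nat (order G) ^ n * (1 / of_nat p ^ n + of_nat p / (of_nat p ^ 2) ^ n - 1 / (of_nat p ^ 3) ^ n :: rat)"
proof -
  let ?p = "of_nat p :: rat" and ?z = "of_nat z :: rat"
  have p: "?p \<noteq> 0" and z: "?z \<noteq> 0"
    using p_pos z_pos by auto
  have ord: "of_nat (order G) = ?p ^ 3 * ?z"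
    using center_index by simp
  have "(?p ^ 2 * ?z) * (of_nat (beta G n) * ?p) = of_nat (beta G n * order G)"
    using ord by (simp add: power2_eq_square power3_eq_cube)
  also have "\<dots> = (?p ^ 2 * ?z) ^ Suc n + ?p ^ 2 * ((?p * ?z) ^ Suc n - ?z ^ Suc n)"
    unfolding beta_times_order[OF finite_carrier] card_commuting_tuples ..
  also have "\<dots> = (?p ^ 2 * ?z) * ((?p ^ 2 * ?z) ^ n + ?p * (?p * ?z) ^ n - ?z ^ n)"
    by (simp add: algebra_simps power2_eq_square)
  finally have "of_nat (beta G n) * ?p = (?p ^ 2 * ?z) ^ n + ?p * (?p * ?z) ^ n - ?z ^ n"
    using p z by simp
  also have "\<dots> = (?p ^ 3 * ?z) ^ n * (1 / ?p ^ n + ?p / (?p ^ 2) ^ n - 1 / (?p ^ 3) ^ n)"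
  proof -
    have "?p ^ 3 * ?z = ?p * (?p ^ 2 * ?z)" "?p ^ 3 * ?z = ?p ^ 2 * (?p * ?z)"
      by (simp_all add: power2_eq_square power3_eq_cube)
    then have eqs: "(?p ^ 3 * ?z) ^ n = ?p ^ n * (?p ^ 2 * ?z) ^ n"
      "(?p ^ 3 * ?z) ^ n = (?p ^ 2) ^ n * (?p * ?z) ^ n"
      "(?p ^ 3 * ?z) ^ n = (?p ^ 3) ^ n * ?z ^ n"
      by (metis power_mult_distrib)+
    have div: "b = a / c" if "a = c * b" "c \<noteq> 0" for a b c :: rat
      using that by simp
    have "(?p ^ 2 * ?z) ^ n = (?p ^ 3 * ?z) ^ n / ?p ^ n"
      using p by (intro div eqs) simp
    moreover have "(?p * ?z) ^ n = (?p ^ 3 * ?z) ^ n / (?p ^ 2) ^ n"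
      using p by (intro div eqs) simp
    moreover have "?z ^ n = (?p ^ 3 * ?z) ^ n / (?p ^ 3) ^ n"
      using p by (intro div eqs) simp
    ultimately have "(?p ^ 2 * ?z) ^ n + ?p * (?p * ?z) ^ n - ?z ^ n = (?p ^ 3 * ?z) ^ n / ?p ^ n
        + ?p * ((?p ^ 3 * ?z) ^ n / (?p ^ 2) ^ n) - (?p ^ 3 * ?z) ^ n / (?p ^ 3) ^ n"
      by (simp only:)
    also have "\<dots> = (?p ^ 3 * ?z) ^ n * (1 / ?p ^ n + ?p / (?p ^ 2) ^ n - 1 / (?p ^ 3) ^ n)"
      by (simp add: distrib_left right_diff_distrib)
    finally show ?thesis .
  qed
  finally show ?thesis
    unfolding ord .
qed

end

text \<open>Multiplying back identifies the quotient: the product of the expected series with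
  \<open>1 - fps_const d * fps_X\<close> collapses to the constant, and this divisor is
  nonzero.\<close>

lemma geom_nth: "fps_nth (geom c d) n = c * d ^ n"
proof -
  have "geom c d = Abs_fps (\<lambda>n. c * d ^ n)"
  proof -
    have "Abs_fps (\<lambda>n. c * d ^ n) * (1 - fps_const d * fps_X) = fps_const c"
    proof (rule fps_ext)
      fix n
      have "Abs_fps (\<lambda>n. c * d ^ n) * (1 - fps_const d * fps_X)
          = Abs_fps (\<lambda>n. c * d ^ n) - fps_const d * (Abs_fps (\<lambda>n. c * d ^ n) * fps_X)"
        by (simp add: right_diff_distrib mult.left_commute)
      then show "fps_nth (Abs_fps (\<lambda>n. c * d ^ n) * (1 - fps_const d * fps_X)) n = fps_nth (fps_const c) n"
        by (cases n) simp_all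
    qed
    moreover have "1 - fps_const d * fps_X \<noteq> 0"
      by (rule fps_nonzeroI[where n = 0]) simp
    ultimately show ?thesis
      unfolding geom_def by (metis nonzero_mult_div_cancel_right)
  qed
  then show ?thesis by simp
qed

section \<open>Commutators and their dependence on cosets of the center\<close>

context group
begin

lemma commutator_closed [simp]:
  "x \<in> carrier G \<Longrightarrow> y \<in> carrier G \<Longrightarrow> commutator G x y \<in> carrier G"
  by (simp add: commutator_def)

lemma commutator_mult:
  assumes "x \<in> carrier G" "y \<in> carrier G"
  shows "commutator G x y \<otimes> (y \<otimes> x) = x \<otimes> y"
proof -
  have "commutator G x y = x \<otimes> y \<otimes> inv (y \<otimes> x)"
    using assms by (simp add: commutator_def inv_mult_group m_assoc)
  then show ?thesis
    using assms by (simp add: m_assoc del: inv_mult_group)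
qed

text \<open>With the convention x y x^-1 y^-1, the commutator is the only left factor that takes y x
  to x y. Checking this equation avoids expanding inverses.\<close>

lemma commutator_unique:
  assumes "x \<in> carrier G" "y \<in> carrier G" "c \<in> carrier G" "c \<otimes> (y \<otimes> x) = x \<otimes> y"
  shows "commutator G x y = c"
proof -
  have "commutator G x y \<otimes> (y \<otimes> x) = c \<otimes> (y \<otimes> x)"
    using assms commutator_mult by simp
  then show ?thesis
    using assms(1-3) right_cancel by simp
qed

lemma commutator_eq_one_iff:
  assumes "x \<in> carrier G" "y \<in> carrier G"
  shows "commutator G x y = \<one> \<longleftrightarrow> x \<otimes> y = y \<otimes> x"
proof
  assume "commutator G x y = \<one>"
  then show "x \<otimes> y = y \<otimes> x"
    using commutator_mult[OF assms] assms by simp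
next
  assume "x \<otimes> y = y \<otimes> x"
  then show "commutator G x y = \<one>"
    using assms by (intro commutator_unique) simp_all
qed

lemma commutator_swap:
  assumes "x \<in> carrier G" "y \<in> carrier G"
  shows "commutator G y x = inv (commutator G x y)"
proof (rule commutator_unique)
  have "inv (commutator G x y) \<otimes> (commutator G x y \<otimes> (y \<otimes> x)) = y \<otimes> x"
    using assms by (simp flip: m_assoc)
  then show "inv (commutator G x y) \<otimes> (x \<otimes> y) = y \<otimes> x"
    unfolding commutator_mult[OF assms] .
qed (use assms in auto)

text \<open>The central factor can be moved to the front of both x y and y x, where it cancels. With
  the swap rule for the second argument, commutators become functions of cosets of the
  center.\<close>

lemma commutator_center_left:
  assumes z: "z \<in> center G" and "x \<in> carrier G" "y \<in> carrier G"
  shows "commutator G (z \<otimes> x) y = commutator G x y"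
proof (rule commutator_unique)
  have zG: "z \<in> carrier G"
    using z center_subset by blast
  have "commutator G x y \<otimes> (y \<otimes> (z \<otimes> x)) = commutator G x y \<otimes> ((y \<otimes> z) \<otimes> x)"
    using assms zG by (simp add: m_assoc)
  also have "y \<otimes> z = z \<otimes> y"
    by (rule center_commute[OF z assms(3), symmetric])
  also have "commutator G x y \<otimes> ((z \<otimes> y) \<otimes> x) = (commutator G x y \<otimes> z) \<otimes> (y \<otimes> x)"
    using assms zG by (simp add: m_assoc)
  also have "commutator G x y \<otimes> z = z \<otimes> commutator G x y"
    by (rule center_commute[OF z commutator_closed[OF assms(2,3)], symmetric])
  also have "(z \<otimes> commutator G x y) \<otimes> (y \<otimes> x) = z \<otimes> (commutator G x y \<otimes> (y \<otimes> x))"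
    using assms zG by (simp add: m_assoc)
  also have "\<dots> = z \<otimes> x \<otimes> y"
    unfolding commutator_mult[OF assms(2,3)] using assms zG by (simp add: m_assoc)
  finally show "commutator G x y \<otimes> (y \<otimes> (z \<otimes> x)) = z \<otimes> x \<otimes> y" .
qed (use assms center_subset in auto)

lemma commutator_center:
  assumes "z \<in> center G" "w \<in> center G" "x \<in> carrier G" "y \<in> carrier G"
  shows "commutator G (z \<otimes> x) (w \<otimes> y) = commutator G x y"
proof -
  have wy: "w \<otimes> y \<in> carrier G"
    using assms center_subset by auto
  have "commutator G (z \<otimes> x) (w \<otimes> y) = commutator G x (w \<otimes> y)"
    using assms wy by (intro commutator_center_left)
  also have "\<dots> = inv (commutator G (w \<otimes> y) x)"
    using assms wy by (intro commutator_swap)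
  also have "commutator G (w \<otimes> y) x = commutator G y x"
    using assms by (intro commutator_center_left)
  also have "inv (commutator G y x) = commutator G x y"
    using assms by (intro commutator_swap[symmetric])
  finally show ?thesis .
qed

lemma center_coset_eq_iff:
  assumes "x \<in> carrier G" "y \<in> carrier G"
  shows "center G #> x = center G #> y \<longleftrightarrow> (\<exists>z \<in> center G. x = z \<otimes> y)"
proof
  assume "center G #> x = center G #> y"
  then show "\<exists>z \<in> center G. x = z \<otimes> y"
    using rcos_self[OF assms(1) subgroup_center] by (auto simp: r_coset_def)
next
  assume "\<exists>z \<in> center G. x = z \<otimes> y"
  then have "x \<in> center G #> y"
    by (auto simp: r_coset_def)
  then show "center G #> x = center G #> y"
    using repr_independence assms(2) subgroup_center by metis
qed

lemma commutator_coset_cong: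
  assumes "x \<in> carrier G" "y \<in> carrier G" "x' \<in> carrier G" "y' \<in> carrier G"
    and "center G #> x = center G #> x'" "center G #> y = center G #> y'"
  shows "commutator G x y = commutator G x' y'"
  using assms center_coset_eq_iff commutator_center by metis

lemma centerI_commutator:
  assumes "x \<in> carrier G" "\<And>y. y \<in> carrier G \<Longrightarrow> commutator G x y = \<one>"
  shows "x \<in> center G"
  using assms(1)
proof (rule centerI)
  show "x \<otimes> y = y \<otimes> x" if "y \<in> carrier G" for y
    using assms that commutator_eq_one_iff by simp
qed

lemma commutator_eq_one_of_center:
  assumes "x \<in> center G" "y \<in> carrier G"
  shows "commutator G x y = \<one>"
  using assms commutator_eq_one_iff center_commute center_subset by blast

lemma derived_eq_generate:
  "derived G (carrier G) = generate G {commutator G x y |x y. x \<in> carrier G \<and> y \<in> carrier G}"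
proof -
  have "derived_set G (carrier G) = {commutator G x y |x y. x \<in> carrier G \<and> y \<in> carrier G}"
    by (auto simp: commutator_def)
  then show ?thesis
    by (simp add: derived_def)
qed

lemma commutator_in_derived:
  "x \<in> carrier G \<Longrightarrow> y \<in> carrier G \<Longrightarrow> commutator G x y \<in> derived G (carrier G)"
  unfolding derived_eq_generate by (rule generate.incl) blast

lemma group_derived_group: "group (derived_group G)"
  unfolding derived_group_def using derived_is_subgroup subgroup_imp_group by blast

end

section \<open>Isoclinism\<close>

text \<open>Isoclinism by data on elements: \<open>f\<close> is multiplicative and surjective only
  up to central factors, and \<open>\<phi>\<close> is merely injective into \<open>H\<close>. The
  isomorphism of central quotients and the surjectivity of \<open>\<phi>\<close> onto the derived
  subgroup follow. This fits the group built below, where \<open>f\<close> need not be a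
  homomorphism.\<close>

definition isoclinism_map ::
    "('a, 'c) monoid_scheme \<Rightarrow> ('b, 'd) monoid_scheme \<Rightarrow> ('a \<Rightarrow> 'b) \<Rightarrow> ('a \<Rightarrow> 'b) \<Rightarrow> bool" where
  "isoclinism_map G H f \<phi> \<longleftrightarrow>
     f \<in> carrier G \<rightarrow> carrier H \<and>
     (\<forall>x \<in> carrier G. \<forall>y \<in> carrier G. \<exists>z \<in> center H. f (x \<otimes>\<^bsub>G\<^esub> y) = z \<otimes>\<^bsub>H\<^esub> (f x \<otimes>\<^bsub>H\<^esub> f y)) \<and>
     (\<forall>k \<in> carrier H. \<exists>x \<in> carrier G. \<exists>z \<in> center H. k = z \<otimes>\<^bsub>H\<^esub> f x) \<and>
     \<phi> \<in> hom (derived_group G) H \<and> inj_on \<phi> (derived G (carrier G)) \<and>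
     (\<forall>x \<in> carrier G. \<forall>y \<in> carrier G. \<phi> (commutator G x y) = commutator H (f x) (f y))"

text \<open>\<open>f\<close> induces a homomorphism from \<open>G\<close> onto the central quotient
  of \<open>H\<close> with kernel the center of \<open>G\<close>: injectivity of
  \<open>\<phi>\<close> makes \<open>x\<close> central when \<open>f x\<close> is, and the converse
  holds because every element of \<open>H\<close> is a value of \<open>f\<close> up to a central
  factor.\<close>

lemma isoclinic_of_isoclinism_map:
  assumes "group G" "group H" "isoclinism_map G H f \<phi>"
  shows "isoclinic G H"
proof -
  interpret G: group G by fact
  interpret H: group H by fact
  interpret D: group "derived_group G" by (rule G.group_derived_group)
  interpret ZH: normal "center H" H by (rule H.normal_center)
  interpret QH: group "H Mod center H" by (rule ZH.factorgroup_is_group)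
  have f: "f x \<in> carrier H" if "x \<in> carrier G" for x
    using assms(3) that by (auto simp: isoclinism_map_def)
  have f_mult: "\<exists>z \<in> center H. f (x \<otimes>\<^bsub>G\<^esub> y) = z \<otimes>\<^bsub>H\<^esub> (f x \<otimes>\<^bsub>H\<^esub> f y)"
    if "x \<in> carrier G" "y \<in> carrier G" for x y
    using assms(3) that by (auto simp: isoclinism_map_def)
  have f_surj: "\<exists>x \<in> carrier G. \<exists>z \<in> center H. k = z \<otimes>\<^bsub>H\<^esub> f x" if "k \<in> carrier H" for k
    using assms(3) that by (auto simp: isoclinism_map_def)
  have \<phi>: "\<phi> \<in> hom (derived_group G) H" "inj_on \<phi> (derived G (carrier G))"
    using assms(3) by (auto simp: isoclinism_map_def)
  have \<phi>_comm: "\<phi> (commutator G x y) = commutator H (f x) (f y)"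
    if "x \<in> carrier G" "y \<in> carrier G" for x y
    using assms(3) that by (auto simp: isoclinism_map_def)
  have carrier_D: "carrier (derived_group G) = derived G (carrier G)"
    by (simp add: derived_group_def)
  interpret \<phi>: group_hom "derived_group G" H \<phi>
    by unfold_locales (rule \<phi>(1))
  have \<phi>_one: "\<phi> \<one>\<^bsub>G\<^esub> = \<one>\<^bsub>H\<^esub>"
    using \<phi>.hom_one by (simp add: derived_group_def)
  have comm_surj: "\<exists>x \<in> carrier G. \<exists>y \<in> carrier G.
      commutator H k l = commutator H (f x) (f y)" if k: "k \<in> carrier H" and l: "l \<in> carrier H" for k l
  proof -
    obtain x z where x: "x \<in> carrier G" "z \<in> center H" "k = z \<otimes>\<^bsub>H\<^esub> f x"
      using f_surj[OF k] by blast
    obtain y w where y: "y \<in> carrier G" "w \<in> center H" "l = w \<otimes>\<^bsub>H\<^esub> f y"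
      using f_surj[OF l] by blast
    have "commutator H k l = commutator H (f x) (f y)"
      using x y H.commutator_center f by simp
    then show ?thesis
      using x y by blast
  qed

  define \<psi> where "\<psi> x = center H #>\<^bsub>H\<^esub> f x" for x
  have "\<psi> \<in> hom G (H Mod center H)"
  proof (rule homI)
    show "\<psi> x \<in> carrier (H Mod center H)" if "x \<in> carrier G" for x
      using f[OF that] by (auto simp: \<psi>_def carrier_FactGroup)
    show "\<psi> (x \<otimes>\<^bsub>G\<^esub> y) = \<psi> x \<otimes>\<^bsub>H Mod center H\<^esub> \<psi> y" if "x \<in> carrier G" "y \<in> carrier G" for x y
    proof -
      have "\<psi> (x \<otimes>\<^bsub>G\<^esub> y) = center H #>\<^bsub>H\<^esub> (f x \<otimes>\<^bsub>H\<^esub> f y)"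
        unfolding \<psi>_def using that f f_mult by (subst H.center_coset_eq_iff) auto
      then show ?thesis
        using that f by (simp add: \<psi>_def ZH.rcos_sum)
    qed
  qed
  then interpret \<psi>: group_hom G "H Mod center H" \<psi>
    by unfold_locales
  have \<psi>_one_iff: "\<psi> x = center H \<longleftrightarrow> x \<in> center G" if x: "x \<in> carrier G" for x
  proof -
    have "\<psi> x = center H \<longleftrightarrow> f x \<in> center H"
      unfolding \<psi>_def using f[OF x] H.coset_join1 H.coset_join2 H.subgroup_center by blast
    also have "\<dots> \<longleftrightarrow> x \<in> center G"
    proof
      assume fx: "f x \<in> center H"
      show "x \<in> center G"
        using x
      proof (rule G.centerI_commutator)
        fix y assume y: "y \<in> carrier G"
        have "\<phi> (commutator G x y) = \<phi> \<one>\<^bsub>G\<^esub>"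
          using \<phi>_comm[OF x y] \<phi>_one H.commutator_eq_one_of_center[OF fx f[OF y]] by simp
        moreover have "commutator G x y \<in> derived G (carrier G)" "\<one>\<^bsub>G\<^esub> \<in> derived G (carrier G)"
          using x y G.commutator_in_derived subgroup.one_closed G.derived_is_subgroup by blast+
        ultimately show "commutator G x y = \<one>\<^bsub>G\<^esub>"
          using \<phi>(2) by (simp add: inj_on_def)
      qed
    next
      assume xZ: "x \<in> center G"
      show "f x \<in> center H"
        using f[OF x]
      proof (rule H.centerI_commutator)
        fix k assume k: "k \<in> carrier H"
        obtain y w where y: "y \<in> carrier G" "w \<in> center H" "k = w \<otimes>\<^bsub>H\<^esub> f y"
          using f_surj[OF k] by blast
        have "\<one>\<^bsub>H\<^esub> \<in> center H"
          using H.subgroup_center subgroup.one_closed by blast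
        then have "commutator H (f x) k = commutator H (f x) (f y)"
          using H.commutator_center[of "\<one>\<^bsub>H\<^esub>" w "f x" "f y"] f x y by simp
        then show "commutator H (f x) k = \<one>\<^bsub>H\<^esub>"
          using \<phi>_comm[OF x y(1)] \<phi>_one G.commutator_eq_one_of_center[OF xZ y(1)] by simp
      qed
    qed
    finally show ?thesis .
  qed
  have kernel: "kernel G (H Mod center H) \<psi> = center G"
    unfolding kernel_def using \<psi>_one_iff G.center_subset by auto
  have "\<psi> ` carrier G = carrier (H Mod center H)"
  proof (intro equalityI image_subsetI subsetI)
    fix R assume "R \<in> carrier (H Mod center H)"
    then obtain k where k: "k \<in> carrier H" "R = center H #>\<^bsub>H\<^esub> k"
      by (auto simp: carrier_FactGroup)
    obtain x z where x: "x \<in> carrier G" "z \<in> center H" "k = z \<otimes>\<^bsub>H\<^esub> f x"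
      using f_surj[OF k(1)] by blast
    then have "R = \<psi> x"
      unfolding k(2) \<psi>_def using H.center_coset_eq_iff[OF k(1) f[OF x(1)]] by blast
    then show "R \<in> \<psi> ` carrier G"
      using x by blast
  qed (use \<psi>.hom_closed in blast)
  from \<psi>.FactGroup_iso_set[OF this]
  have \<theta>: "(\<lambda>X. the_elem (\<psi> ` X)) \<in> iso (G Mod center G) (H Mod center H)"
    unfolding kernel .
  \<comment> \<open>The first isomorphism theorem gives the isomorphism as the sole element of an
    image set; evaluated on a coset it is \<open>\<psi>\<close> at any representative.\<close>
  have \<theta>_coset: "the_elem (\<psi> ` (center G #>\<^bsub>G\<^esub> x)) = \<psi> x" if x: "x \<in> carrier G" for x
  proof -
    have "\<psi> (z \<otimes>\<^bsub>G\<^esub> x) = \<psi> x" if z: "z \<in> center G" for z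
    proof -
      have zG: "z \<in> carrier G"
        using z G.center_subset by blast
      then have "\<psi> (z \<otimes>\<^bsub>G\<^esub> x) = \<psi> z \<otimes>\<^bsub>H Mod center H\<^esub> \<psi> x"
        using x by simp
      also have "\<psi> z = \<one>\<^bsub>H Mod center H\<^esub>"
        using \<psi>_one_iff[OF zG] z by simp
      finally show ?thesis
        using x by (simp del: one_FactGroup mult_FactGroup)
    qed
    moreover have "center G \<noteq> {}"
      using G.subgroup_center subgroup.one_closed by blast
    ultimately have "\<psi> ` (center G #>\<^bsub>G\<^esub> x) = {\<psi> x}"
      by (auto simp: r_coset_def)
    then show ?thesis by simp
  qed

  \<comment> \<open>Every commutator of \<open>H\<close> is a commutator of two values of
    \<open>f\<close>, so \<open>\<phi>\<close> maps the generators of one derived subgroup onto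
    those of the other.\<close>
  have "\<phi> ` derived G (carrier G) = derived H (carrier H)"
  proof -
    let ?K = "{commutator G x y |x y. x \<in> carrier G \<and> y \<in> carrier G}"
    have K: "?K \<subseteq> derived G (carrier G)"
      using G.commutator_in_derived by blast
    have "\<phi> ` ?K = {commutator H k l |k l. k \<in> carrier H \<and> l \<in> carrier H}"
    proof (intro equalityI subsetI)
      fix c assume "c \<in> {commutator H k l |k l. k \<in> carrier H \<and> l \<in> carrier H}"
      then obtain k l where "k \<in> carrier H" "l \<in> carrier H" "c = commutator H k l"
        by blast
      then obtain x y where xy: "x \<in> carrier G" "y \<in> carrier G" "c = commutator H (f x) (f y)"
        using comm_surj by blast
      show "c \<in> \<phi> ` ?K"
        unfolding xy(3) \<phi>_comm[OF xy(1,2), symmetric] using xy(1,2) by blast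
    next
      fix c assume "c \<in> \<phi> ` ?K"
      then obtain x y where xy: "x \<in> carrier G" "y \<in> carrier G" "c = \<phi> (commutator G x y)"
        by blast
      show "c \<in> {commutator H k l |k l. k \<in> carrier H \<and> l \<in> carrier H}"
        unfolding xy(3) \<phi>_comm[OF xy(1,2)] using f[OF xy(1)] f[OF xy(2)] by blast
    qed
    then have "derived H (carrier H) = generate H (\<phi> ` ?K)"
      by (simp add: H.derived_eq_generate)
    also have "\<dots> = \<phi> ` generate (derived_group G) ?K"
      using \<phi>.generate_img K by (simp add: carrier_D)
    also have "generate (derived_group G) ?K = generate G ?K"
      unfolding derived_group_def
      using G.generate_consistent[OF K] G.derived_is_subgroup by simp
    also have "\<dots> = derived G (carrier G)"
      by (simp add: G.derived_eq_generate)
    finally show ?thesis ..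
  qed
  then have "\<phi> \<in> iso (derived_group G) (derived_group H)"
    using \<phi> unfolding iso_def hom_def bij_betw_def derived_group_def by auto
  moreover have "\<phi> (commutator G g\<^sub>1 g\<^sub>2) = commutator H h\<^sub>1 h\<^sub>2"
    if "g\<^sub>1 \<in> carrier G" "g\<^sub>2 \<in> carrier G" "h\<^sub>1 \<in> carrier H" "h\<^sub>2 \<in> carrier H"
      and "the_elem (\<psi> ` (center G #>\<^bsub>G\<^esub> g\<^sub>1)) = center H #>\<^bsub>H\<^esub> h\<^sub>1"
      and "the_elem (\<psi> ` (center G #>\<^bsub>G\<^esub> g\<^sub>2)) = center H #>\<^bsub>H\<^esub> h\<^sub>2"
    for g\<^sub>1 g\<^sub>2 h\<^sub>1 h\<^sub>2
  proof -
    have "center H #>\<^bsub>H\<^esub> f g\<^sub>1 = center H #>\<^bsub>H\<^esub> h\<^sub>1" "center H #>\<^bsub>H\<^esub> f g\<^sub>2 = center H #>\<^bsub>H\<^esub> h\<^sub>2"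
      using that \<theta>_coset by (simp_all add: \<psi>_def)
    from H.commutator_coset_cong[OF f[OF that(1)] f[OF that(2)] that(3,4) this]
    show ?thesis
      using \<phi>_comm[OF that(1,2)] by simp
  qed
  ultimately show ?thesis
    unfolding isoclinic_def by (intro bexI[OF _ \<theta>] bexI[where x = \<phi>] ballI impI)
qed

lemma isoclinism_map_comp_iso:
  assumes "group G" "group K" "isoclinism_map G K f \<phi>" "group N" "\<iota> \<in> iso K N"
  shows "isoclinism_map G N (\<iota> \<circ> f) (\<iota> \<circ> \<phi>)"
proof -
  interpret G: group G by fact
  interpret K: group K by fact
  interpret N: group N by fact
  interpret \<iota>: group_hom K N \<iota>
    using assms(5) by unfold_locales (simp add: iso_def)
  have bij: "bij_betw \<iota> (carrier K) (carrier N)"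
    using assms(5) by (simp add: iso_def)
  have f: "f x \<in> carrier K" if "x \<in> carrier G" for x
    using assms(3) that by (auto simp: isoclinism_map_def)
  have center: "\<iota> z \<in> center N" if z: "z \<in> center K" for z
  proof (rule N.centerI)
    have zK: "z \<in> carrier K"
      using z K.center_subset by blast
    then show "\<iota> z \<in> carrier N"
      by simp
    fix n assume "n \<in> carrier N"
    then obtain k where k: "k \<in> carrier K" "n = \<iota> k"
      using bij by (metis bij_betw_imp_surj_on imageE)
    show "\<iota> z \<otimes>\<^bsub>N\<^esub> n = n \<otimes>\<^bsub>N\<^esub> \<iota> z"
      using K.center_commute[OF z k(1)] \<iota>.hom_mult[OF zK k(1)] \<iota>.hom_mult[OF k(1) zK]
      unfolding k(2) by simp
  qed
  show ?thesis
    unfolding isoclinism_map_def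
  proof (intro conjI ballI)
    show "\<iota> \<circ> f \<in> carrier G \<rightarrow> carrier N"
      using f by auto
    show "\<exists>z \<in> center N. (\<iota> \<circ> f) (x \<otimes>\<^bsub>G\<^esub> y) = z \<otimes>\<^bsub>N\<^esub> ((\<iota> \<circ> f) x \<otimes>\<^bsub>N\<^esub> (\<iota> \<circ> f) y)"
      if xy: "x \<in> carrier G" "y \<in> carrier G" for x y
    proof -
      obtain z where z: "z \<in> center K" "f (x \<otimes>\<^bsub>G\<^esub> y) = z \<otimes>\<^bsub>K\<^esub> (f x \<otimes>\<^bsub>K\<^esub> f y)"
        using assms(3) xy unfolding isoclinism_map_def by blast
      then have "(\<iota> \<circ> f) (x \<otimes>\<^bsub>G\<^esub> y) = \<iota> z \<otimes>\<^bsub>N\<^esub> ((\<iota> \<circ> f) x \<otimes>\<^bsub>N\<^esub> (\<iota> \<circ> f) y)"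
        using f xy subsetD[OF K.center_subset] G.m_closed by simp
      then show ?thesis
        using center[OF z(1)] by blast
    qed
    show "\<exists>x \<in> carrier G. \<exists>z \<in> center N. n = z \<otimes>\<^bsub>N\<^esub> (\<iota> \<circ> f) x" if n: "n \<in> carrier N" for n
    proof -
      obtain k where k: "k \<in> carrier K" "n = \<iota> k"
        using bij n by (metis bij_betw_imp_surj_on imageE)
      obtain x z where x: "x \<in> carrier G" "z \<in> center K" "k = z \<otimes>\<^bsub>K\<^esub> f x"
        using assms(3) k unfolding isoclinism_map_def by blast
      then have "n = \<iota> z \<otimes>\<^bsub>N\<^esub> (\<iota> \<circ> f) x"
        using k f subsetD[OF K.center_subset] by simp
      then show ?thesis
        using x(1) center[OF x(2)] by blast
    qed
    have \<phi>: "\<phi> \<in> hom (derived_group G) K" "inj_on \<phi> (derived G (carrier G))"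
      using assms(3) by (auto simp: isoclinism_map_def)
    then show "\<iota> \<circ> \<phi> \<in> hom (derived_group G) N"
      using hom_compose \<iota>.homh by blast
    have "\<phi> ` derived G (carrier G) \<subseteq> carrier K"
      using \<phi>(1) by (auto simp: hom_def derived_group_def)
    then show "inj_on (\<iota> \<circ> \<phi>) (derived G (carrier G))"
      using \<phi>(2) bij by (meson bij_betw_imp_inj_on comp_inj_on inj_on_subset)
    show "(\<iota> \<circ> \<phi>) (commutator G x y) = commutator N ((\<iota> \<circ> f) x) ((\<iota> \<circ> f) y)"
      if "x \<in> carrier G" "y \<in> carrier G" for x y
    proof -
      have "\<phi> (commutator G x y) = commutator K (f x) (f y)"
        using assms(3) that by (auto simp: isoclinism_map_def)
      then show ?thesis
        using f that by (simp add: commutator_def)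
    qed
  qed
qed

text \<open>\<open>family_rank\<close> ranges over groups of natural numbers, while constructed
  groups live on other types; a finite carrier injects into the naturals and carries the structure
  along.\<close>

lemma exists_isoclinic_nat_group:
  assumes "group G" "group K" "isoclinism_map G K f \<phi>" "finite (carrier K)"
  shows "\<exists>N :: nat monoid. group N \<and> order N = order K \<and> isoclinic G N"
proof -
  interpret K: group K by fact
  obtain \<iota> :: "_ \<Rightarrow> nat" where \<iota>: "inj_on \<iota> (carrier K)"
    using assms(4) by (meson bij_betw_def ex_bij_betw_finite_nat)
  have iso: "\<iota> \<in> iso K (image_group \<iota> K)"
    using \<iota> by (rule inj_imp_image_group_iso)
  have N: "group (image_group \<iota> K)"
    using \<iota> by (rule K.inj_imp_image_group_is_group)
  have "isoclinic G (image_group \<iota> K)"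
    using assms(1) N isoclinism_map_comp_iso[OF assms(1-3) N iso]
    by (rule isoclinic_of_isoclinism_map)
  moreover have "order (image_group \<iota> K) = order K"
    using \<iota> by (simp add: order_def image_group_carrier card_image)
  ultimately show ?thesis
    using N by blast
qed

lemma isoclinism_map_refl:
  assumes "group G"
  shows "isoclinism_map G G id id"
proof -
  interpret group G by fact
  have one: "\<one>\<^bsub>G\<^esub> \<in> center G"
    using subgroup_center subgroup.one_closed by blast
  have "derived G (carrier G) \<subseteq> carrier G"
    using derived_in_carrier by blast
  moreover have "\<exists>x \<in> carrier G. \<exists>z \<in> center G. k = z \<otimes>\<^bsub>G\<^esub> x" if "k \<in> carrier G" for k
    using that one by (intro bexI[of _ k] bexI[OF _ one]) simp_all
  moreover have "\<exists>z \<in> center G. x \<otimes>\<^bsub>G\<^esub> y = z \<otimes>\<^bsub>G\<^esub> (x \<otimes>\<^bsub>G\<^esub> y)"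
    if "x \<in> carrier G" "y \<in> carrier G" for x y
    using that one by (intro bexI[OF _ one]) simp
  ultimately show ?thesis
    unfolding isoclinism_map_def derived_group_def by (auto simp: hom_def)
qed

lemma family_rank_le:
  assumes "group G" "group K" "isoclinism_map G K f \<phi>" "order K = p ^ r" "p > 0"
  shows "family_rank p G \<le> r"
proof -
  interpret K: group K by fact
  have "finite (carrier K)"
    using assms by (simp flip: K.order_gt_0_iff_finite)
  then obtain N :: "nat monoid" where "group N" "order N = p ^ r" "isoclinic G N"
    using exists_isoclinic_nat_group[OF assms(1-3)] assms(4) by auto
  then show ?thesis
    unfolding family_rank_def by (intro Least_le) blast
qed

text \<open>The minimum is over a nonempty set: \<open>G\<close> itself, copied to the naturals,
  realizes the exponent \<open>m\<close>.\<close>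

lemma (in prime_power_group) family_rank_attained:
  "\<exists>H :: nat monoid. group H \<and> order H = p ^ family_rank p G \<and> isoclinic G H"
proof -
  have "\<exists>r. \<exists>H :: nat monoid. group H \<and> order H = p ^ r \<and> isoclinic G H"
    using exists_isoclinic_nat_group[OF is_group is_group isoclinism_map_refl[OF is_group] finite_carrier]
      order_eq by metis
  then show ?thesis
    unfolding family_rank_def by (rule LeastI_ex)
qed

section \<open>Numerical invariants of isoclinism\<close>

lemma (in group) card_image_cosets:
  assumes "subgroup N G" "subgroup C G" "N \<subseteq> C"
  shows "card ((\<lambda>x. N #> x) ` C) * card N = card C"
proof -
  interpret C: group "G\<lparr>carrier := C\<rparr>"
    using assms(2) by (rule subgroup_imp_group)
  have "rcosets\<^bsub>G\<lparr>carrier := C\<rparr>\<^esub> N = (\<lambda>x. N #> x) ` C"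
    by (auto simp: RCOSETS_def)
  then show ?thesis
    using C.lagrange[OF subgroup_incl[OF assms]] by (simp add: order_def)
qed

text \<open>Since \<open>\<phi>\<close> is injective, whether two elements commute is preserved when
  their cosets correspond under \<open>\<theta>\<close>; so \<open>\<theta>\<close> maps C(g)/Z(G)
  onto C(h)/Z(H). The equality of indices is cross-multiplied to avoid division.\<close>

lemma isoclinic_card_eqs:
  assumes "group G" "group H" "isoclinic G H"
  shows "card (rcosets\<^bsub>G\<^esub> (center G)) = card (rcosets\<^bsub>H\<^esub> (center H))"
    and "h \<in> carrier H \<Longrightarrow> \<exists>g \<in> carrier G. card (centralizer G g) * card (center H)
           = card (centralizer H h) * card (center G)"
proof -
  interpret G: group G by fact
  interpret H: group H by fact
  obtain \<theta> \<phi> where \<theta>: "\<theta> \<in> iso (G Mod center G) (H Mod center H)"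
    and \<phi>: "\<phi> \<in> iso (derived_group G) (derived_group H)"
    and comm: "\<And>g\<^sub>1 g\<^sub>2 h\<^sub>1 h\<^sub>2. \<lbrakk>g\<^sub>1 \<in> carrier G; g\<^sub>2 \<in> carrier G; h\<^sub>1 \<in> carrier H; h\<^sub>2 \<in> carrier H;
        \<theta> (center G #>\<^bsub>G\<^esub> g\<^sub>1) = center H #>\<^bsub>H\<^esub> h\<^sub>1; \<theta> (center G #>\<^bsub>G\<^esub> g\<^sub>2) = center H #>\<^bsub>H\<^esub> h\<^sub>2\<rbrakk>
        \<Longrightarrow> \<phi> (commutator G g\<^sub>1 g\<^sub>2) = commutator H h\<^sub>1 h\<^sub>2"
    using assms(3) unfolding isoclinic_def by blast
  have bij: "bij_betw \<theta> (rcosets\<^bsub>G\<^esub> (center G)) (rcosets\<^bsub>H\<^esub> (center H))"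
    using \<theta> by (simp add: iso_def FactGroup_def)
  then show "card (rcosets\<^bsub>G\<^esub> (center G)) = card (rcosets\<^bsub>H\<^esub> (center H))"
    by (rule bij_betw_same_card)
  interpret \<phi>: group_hom "derived_group G" "derived_group H" \<phi>
    using \<phi> G.group_derived_group H.group_derived_group
    by (simp add: group_hom_def group_hom_axioms_def iso_def)
  have "\<phi> \<one>\<^bsub>G\<^esub> = \<one>\<^bsub>H\<^esub>"
    using \<phi>.hom_one by (simp add: derived_group_def)
  moreover have "inj_on \<phi> (derived G (carrier G))"
    using \<phi> by (simp add: iso_def bij_betw_def derived_group_def)
  moreover have "\<one>\<^bsub>G\<^esub> \<in> derived G (carrier G)"
    using G.derived_is_subgroup subgroup.one_closed by blast
  ultimately have \<phi>_one_iff: "\<phi> c = \<one>\<^bsub>H\<^esub> \<longleftrightarrow> c = \<one>\<^bsub>G\<^esub>" if "c \<in> derived G (carrier G)" for c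
    using that by (metis inj_onD)
  have commute: "g\<^sub>1 \<in> centralizer G g\<^sub>2 \<longleftrightarrow> h\<^sub>1 \<in> centralizer H h\<^sub>2"
    if "g\<^sub>1 \<in> carrier G" "g\<^sub>2 \<in> carrier G" "h\<^sub>1 \<in> carrier H" "h\<^sub>2 \<in> carrier H"
      "\<theta> (center G #>\<^bsub>G\<^esub> g\<^sub>1) = center H #>\<^bsub>H\<^esub> h\<^sub>1" "\<theta> (center G #>\<^bsub>G\<^esub> g\<^sub>2) = center H #>\<^bsub>H\<^esub> h\<^sub>2"
    for g\<^sub>1 g\<^sub>2 h\<^sub>1 h\<^sub>2
  proof -
    have "commutator G g\<^sub>1 g\<^sub>2 = \<one>\<^bsub>G\<^esub> \<longleftrightarrow> commutator H h\<^sub>1 h\<^sub>2 = \<one>\<^bsub>H\<^esub>"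
      using comm[OF that] \<phi>_one_iff[OF G.commutator_in_derived[OF that(1,2)]] by simp
    then show ?thesis
      using that G.commutator_eq_one_iff H.commutator_eq_one_iff by (simp add: centralizer_def)
  qed
  have lift_H: "\<exists>k \<in> carrier H. \<theta> (center G #>\<^bsub>G\<^esub> g) = center H #>\<^bsub>H\<^esub> k" if "g \<in> carrier G" for g
  proof -
    have "center G #>\<^bsub>G\<^esub> g \<in> rcosets\<^bsub>G\<^esub> (center G)"
      using that by (auto simp: RCOSETS_def)
    then have "\<theta> (center G #>\<^bsub>G\<^esub> g) \<in> rcosets\<^bsub>H\<^esub> (center H)"
      using bij by (rule bij_betw_apply[rotated])
    then show ?thesis
      by (auto simp: RCOSETS_def)
  qed
  have lift_G: "\<exists>g \<in> carrier G. \<theta> (center G #>\<^bsub>G\<^esub> g) = center H #>\<^bsub>H\<^esub> k" if "k \<in> carrier H" for k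
  proof -
    have "center H #>\<^bsub>H\<^esub> k \<in> rcosets\<^bsub>H\<^esub> (center H)"
      using that by (auto simp: RCOSETS_def)
    then obtain R where "R \<in> rcosets\<^bsub>G\<^esub> (center G)" "\<theta> R = center H #>\<^bsub>H\<^esub> k"
      using bij by (metis bij_betw_imp_surj_on imageE)
    then show ?thesis
      by (auto simp: RCOSETS_def)
  qed
  show "\<exists>g \<in> carrier G. card (centralizer G g) * card (center H) = card (centralizer H h) * card (center G)"
    if h: "h \<in> carrier H"
  proof -
    obtain g where g: "g \<in> carrier G" "\<theta> (center G #>\<^bsub>G\<^esub> g) = center H #>\<^bsub>H\<^esub> h"
      using lift_G[OF h] by blast
    let ?CG = "(\<lambda>x. center G #>\<^bsub>G\<^esub> x) ` centralizer G g"
    let ?CH = "(\<lambda>x. center H #>\<^bsub>H\<^esub> x) ` centralizer H h"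
    have "\<theta> ` ?CG = ?CH"
    proof (intro equalityI subsetI)
      fix R assume "R \<in> \<theta> ` ?CG"
      then obtain y where y: "y \<in> centralizer G g" "R = \<theta> (center G #>\<^bsub>G\<^esub> y)"
        by blast
      then have yG: "y \<in> carrier G"
        using G.centralizer_subset by blast
      then obtain k where k: "k \<in> carrier H" "\<theta> (center G #>\<^bsub>G\<^esub> y) = center H #>\<^bsub>H\<^esub> k"
        using lift_H by blast
      then have "k \<in> centralizer H h"
        using commute[OF yG g(1) k(1) h k(2) g(2)] y(1) by simp
      then show "R \<in> ?CH"
        unfolding y(2) k(2) by blast
    next
      fix R assume "R \<in> ?CH"
      then obtain k where k: "k \<in> centralizer H h" "R = center H #>\<^bsub>H\<^esub> k"
        by blast
      then have kH: "k \<in> carrier H"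
        using H.centralizer_subset by blast
      then obtain y where y: "y \<in> carrier G" "\<theta> (center G #>\<^bsub>G\<^esub> y) = center H #>\<^bsub>H\<^esub> k"
        using lift_G by blast
      then have "y \<in> centralizer G g"
        using commute[OF y(1) g(1) kH h y(2) g(2)] k(1) by simp
      then show "R \<in> \<theta> ` ?CG"
        unfolding k(2) y(2)[symmetric] by blast
    qed
    moreover have "?CG \<subseteq> rcosets\<^bsub>G\<^esub> (center G)"
      using G.centralizer_subset by (auto simp: RCOSETS_def)
    then have "inj_on \<theta> ?CG"
      using bij inj_on_subset by (auto simp: bij_betw_def)
    ultimately have "card ?CG = card ?CH"
      using card_image by metis
    moreover have "card ?CG * card (center G) = card (centralizer G g)"
      using G.card_image_cosets[OF G.subgroup_center G.subgroup_centralizer[OF g(1)]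
          G.center_subset_centralizer[OF g(1)]] .
    moreover have "card ?CH * card (center H) = card (centralizer H h)"
      using H.card_image_cosets[OF H.subgroup_center H.subgroup_centralizer[OF h]
          H.center_subset_centralizer[OF h]] .
    ultimately have "card (centralizer G g) * card (center H) = card (centralizer H h) * card (center G)"
      by (metis mult.assoc mult.commute)
    then show ?thesis
      using g(1) by blast
  qed
qed

section \<open>Groups of class two\<close>

text \<open>The central extension of \<open>Q\<close> by \<open>U\<close> with 2-cocycle
  \<open>c\<close>. A bilinear \<open>c\<close> satisfies the cocycle identity, which is
  associativity here.\<close>

definition pairing_group ::
    "('a, 'c) monoid_scheme \<Rightarrow> ('b, 'd) monoid_scheme \<Rightarrow> ('a \<Rightarrow> 'a \<Rightarrow> 'b) \<Rightarrow> ('a \<times> 'b) monoid" where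
  "pairing_group Q U c =
     \<lparr>carrier = carrier Q \<times> carrier U,
      monoid.mult = (\<lambda>(a, u) (b, v). (a \<otimes>\<^bsub>Q\<^esub> b, u \<otimes>\<^bsub>U\<^esub> v \<otimes>\<^bsub>U\<^esub> c a b)),
      one = (\<one>\<^bsub>Q\<^esub>, \<one>\<^bsub>U\<^esub>)\<rparr>"

locale bilinear_pairing = Q: comm_group Q + U: comm_group U
  for Q :: "('a, 'c) monoid_scheme" and U :: "('b, 'd) monoid_scheme" +
  fixes c :: "'a \<Rightarrow> 'a \<Rightarrow> 'b"
  assumes closed: "\<And>a b. a \<in> carrier Q \<Longrightarrow> b \<in> carrier Q \<Longrightarrow> c a b \<in> carrier U"
    and left: "\<And>a b d. a \<in> carrier Q \<Longrightarrow> b \<in> carrier Q \<Longrightarrow> d \<in> carrier Q \<Longrightarrow>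
      c (a \<otimes>\<^bsub>Q\<^esub> b) d = c a d \<otimes>\<^bsub>U\<^esub> c b d"
    and right: "\<And>a b d. a \<in> carrier Q \<Longrightarrow> b \<in> carrier Q \<Longrightarrow> d \<in> carrier Q \<Longrightarrow>
      c d (a \<otimes>\<^bsub>Q\<^esub> b) = c d a \<otimes>\<^bsub>U\<^esub> c d b"
begin

abbreviation K where "K \<equiv> pairing_group Q U c"

lemma carrier_K: "carrier K = carrier Q \<times> carrier U"
  and one_K: "\<one>\<^bsub>K\<^esub> = (\<one>\<^bsub>Q\<^esub>, \<one>\<^bsub>U\<^esub>)"
  and mult_K: "(a, u) \<otimes>\<^bsub>K\<^esub> (b, v) = (a \<otimes>\<^bsub>Q\<^esub> b, u \<otimes>\<^bsub>U\<^esub> v \<otimes>\<^bsub>U\<^esub> c a b)"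
  by (simp_all add: pairing_group_def)

lemma one_left: "a \<in> carrier Q \<Longrightarrow> c \<one>\<^bsub>Q\<^esub> a = \<one>\<^bsub>U\<^esub>"
  using left[of "\<one>\<^bsub>Q\<^esub>" "\<one>\<^bsub>Q\<^esub>" a] closed[of "\<one>\<^bsub>Q\<^esub>" a] by simp

lemma one_right: "a \<in> carrier Q \<Longrightarrow> c a \<one>\<^bsub>Q\<^esub> = \<one>\<^bsub>U\<^esub>"
  using right[of "\<one>\<^bsub>Q\<^esub>" "\<one>\<^bsub>Q\<^esub>" a] closed[of a "\<one>\<^bsub>Q\<^esub>"] by simp

lemma group_K: "group K"
proof (rule groupI)
  fix x y z assume "x \<in> carrier K" "y \<in> carrier K" "z \<in> carrier K"
  then show "x \<otimes>\<^bsub>K\<^esub> y \<otimes>\<^bsub>K\<^esub> z = x \<otimes>\<^bsub>K\<^esub> (y \<otimes>\<^bsub>K\<^esub> z)"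
    by (cases x; cases y; cases z) (simp add: carrier_K mult_K Q.m_assoc U.m_ac left right closed)
next
  fix x assume "x \<in> carrier K"
  then obtain a u where x: "x = (a, u)" "a \<in> carrier Q" "u \<in> carrier U"
    by (auto simp: carrier_K)
  \<comment> \<open>For second component w of \<open>?y\<close>, the product with \<open>x\<close>
    has second component w u c(a^-1, a); w is chosen to make this trivial.\<close>
  let ?y = "(inv\<^bsub>Q\<^esub> a, inv\<^bsub>U\<^esub> (u \<otimes>\<^bsub>U\<^esub> c (inv\<^bsub>Q\<^esub> a) a))"
  have "?y \<otimes>\<^bsub>K\<^esub> x = \<one>\<^bsub>K\<^esub>"
    using x closed by (simp add: mult_K one_K U.m_assoc)
  moreover have "?y \<in> carrier K"
    using x closed by (simp add: carrier_K)
  ultimately show "\<exists>y \<in> carrier K. y \<otimes>\<^bsub>K\<^esub> x = \<one>\<^bsub>K\<^esub>"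
    by blast
next
  show "x \<otimes>\<^bsub>K\<^esub> y \<in> carrier K" if "x \<in> carrier K" "y \<in> carrier K" for x y
    using that by (cases x; cases y) (simp add: carrier_K mult_K closed)
  show "\<one>\<^bsub>K\<^esub> \<otimes>\<^bsub>K\<^esub> x = x" if "x \<in> carrier K" for x
    using that by (cases x) (simp add: carrier_K mult_K one_K one_left)
qed (simp add: carrier_K one_K)

lemma central_mult:
  assumes "u \<in> carrier U" "a \<in> carrier Q" "v \<in> carrier U"
  shows "(\<one>\<^bsub>Q\<^esub>, u) \<otimes>\<^bsub>K\<^esub> (a, v) = (a, u \<otimes>\<^bsub>U\<^esub> v)"
  using assms by (simp add: mult_K one_left)

lemma in_center:
  assumes "u \<in> carrier U"
  shows "(\<one>\<^bsub>Q\<^esub>, u) \<in> center K"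
proof -
  interpret K: group K by (rule group_K)
  show ?thesis
  proof (rule K.centerI)
    show "(\<one>\<^bsub>Q\<^esub>, u) \<in> carrier K"
      using assms by (simp add: carrier_K)
    show "(\<one>\<^bsub>Q\<^esub>, u) \<otimes>\<^bsub>K\<^esub> x = x \<otimes>\<^bsub>K\<^esub> (\<one>\<^bsub>Q\<^esub>, u)" if "x \<in> carrier K" for x
      using that assms by (cases x) (simp add: carrier_K mult_K one_left one_right U.m_comm)
  qed
qed

text \<open>As \<open>Q\<close> is abelian, the two products differ only in \<open>c a b\<close>
  against \<open>c b a\<close>. A prescribed commutator map is therefore obtained by taking half of
  it for \<open>c\<close>.\<close>

lemma commutator_K:
  assumes "a \<in> carrier Q" "u \<in> carrier U" "b \<in> carrier Q" "v \<in> carrier U"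
  shows "commutator K (a, u) (b, v) = (\<one>\<^bsub>Q\<^esub>, c a b \<otimes>\<^bsub>U\<^esub> inv\<^bsub>U\<^esub> (c b a))"
proof -
  interpret K: group K by (rule group_K)
  have "c a b \<otimes>\<^bsub>U\<^esub> inv\<^bsub>U\<^esub> (c b a) \<otimes>\<^bsub>U\<^esub> (v \<otimes>\<^bsub>U\<^esub> u \<otimes>\<^bsub>U\<^esub> c b a)
      = (inv\<^bsub>U\<^esub> (c b a) \<otimes>\<^bsub>U\<^esub> c b a) \<otimes>\<^bsub>U\<^esub> (u \<otimes>\<^bsub>U\<^esub> v \<otimes>\<^bsub>U\<^esub> c a b)"
    using assms closed by (simp add: U.m_ac del: U.l_inv U.r_inv)
  also have "\<dots> = u \<otimes>\<^bsub>U\<^esub> v \<otimes>\<^bsub>U\<^esub> c a b"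
    using assms closed by simp
  finally show ?thesis
    using assms closed
    by (intro K.commutator_unique) (simp_all add: carrier_K mult_K one_left Q.m_comm)
qed

end

text \<open>In general [x y, t] = x [y, t] x^-1 [x, t]; centrality of [y, t] lets it pass
  \<open>x\<close>.\<close>

lemma (in group) commutator_mult_left:
  assumes "x \<in> carrier G" "y \<in> carrier G" "t \<in> carrier G" "commutator G y t \<in> center G"
  shows "commutator G (x \<otimes> y) t = commutator G x t \<otimes> commutator G y t"
proof (rule commutator_unique)
  let ?a = "commutator G x t" and ?b = "commutator G y t"
  have carr: "?a \<in> carrier G" "?b \<in> carrier G"
    using assms by simp_all
  have "x \<otimes> y \<otimes> t = x \<otimes> (?b \<otimes> (t \<otimes> y))"
    unfolding commutator_mult[OF assms(2,3)] using assms by (simp add: m_assoc)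
  also have "\<dots> = (x \<otimes> ?b) \<otimes> (t \<otimes> y)"
    using assms carr by (simp add: m_assoc)
  also have "x \<otimes> ?b = ?b \<otimes> x"
    by (rule center_commute[OF assms(4,1), symmetric])
  also have "?b \<otimes> x \<otimes> (t \<otimes> y) = ?b \<otimes> (x \<otimes> t) \<otimes> y"
    using assms carr by (simp add: m_assoc)
  also have "x \<otimes> t = ?a \<otimes> (t \<otimes> x)"
    using commutator_mult[OF assms(1,3)] by simp
  also have "?b \<otimes> (?a \<otimes> (t \<otimes> x)) \<otimes> y = ?b \<otimes> ?a \<otimes> (t \<otimes> (x \<otimes> y))"
    using assms carr by (simp add: m_assoc)
  also have "?b \<otimes> ?a = ?a \<otimes> ?b"
    by (rule center_commute[OF assms(4) carr(1)])
  finally show "?a \<otimes> ?b \<otimes> (t \<otimes> (x \<otimes> y)) = x \<otimes> y \<otimes> t" ..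
qed (use assms in simp_all)

text \<open>The commutator pairing on the central quotient. The choice of representatives does not
  affect its value on cosets of the center.\<close>

definition coset_commutator :: "('a, 'b) monoid_scheme \<Rightarrow> 'a set \<Rightarrow> 'a set \<Rightarrow> 'a" where
  "coset_commutator G R S = commutator G (SOME r. r \<in> R) (SOME s. s \<in> S)"

lemma (in group) coset_commutator_eq:
  assumes "x \<in> carrier G" "y \<in> carrier G"
  shows "coset_commutator G (center G #> x) (center G #> y) = commutator G x y"
proof -
  have rep: "(SOME r. r \<in> center G #> x) \<in> carrier G \<and>
      center G #> (SOME r. r \<in> center G #> x) = center G #> x" if x: "x \<in> carrier G" for x
  proof -
    have "(SOME r. r \<in> center G #> x) \<in> center G #> x"
      using rcos_self[OF x subgroup_center] by (rule someI)
    then show ?thesis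
      using repr_independence[OF _ x subgroup_center] r_coset_subset_G[OF center_subset x] by blast
  qed
  show ?thesis
    unfolding coset_commutator_def
    using rep[OF assms(1)] rep[OF assms(2)] assms by (intro commutator_coset_cong) auto
qed

text \<open>Baer's trick: dividing the commutator pairing by two turns \<open>G/Z(G) \<times> G'\<close> into a stem group
  of the isoclinism family of \<open>G\<close>.\<close>

lemma (in group) exists_stem_of_class_two:
  fixes n :: nat
  assumes class2: "derived G (carrier G) \<subseteq> center G"
    and odd: "odd n" and exponent: "\<And>u. u \<in> derived G (carrier G) \<Longrightarrow> u [^] n = \<one>"
  shows "\<exists>(K :: ('a set \<times> 'a) monoid) f \<phi>. group K \<and>
    order K = card (rcosets (center G)) * card (derived G (carrier G)) \<and> isoclinism_map G K f \<phi>"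
proof -
  let ?Z = "center G" and ?Q = "G Mod center G" and ?U = "derived_group G"
  interpret Z: normal "center G" G by (rule normal_center)
  interpret Q: group ?Q by (rule Z.factorgroup_is_group)
  interpret U: group ?U by (rule group_derived_group)
  have carrier_U: "carrier ?U = derived G (carrier G)" and mult_U: "\<And>u v. u \<otimes>\<^bsub>?U\<^esub> v = u \<otimes> v"
    and one_U: "\<one>\<^bsub>?U\<^esub> = \<one>"
    by (simp_all add: derived_group_def)
  have carrier_Q: "carrier ?Q = rcosets ?Z"
    by (simp add: FactGroup_def)
  have comm_central: "commutator G x y \<in> center G" if "x \<in> carrier G" "y \<in> carrier G" for x y
    using that class2 commutator_in_derived by blast
  have comm_U: "commutator G x y \<in> carrier ?U" if "x \<in> carrier G" "y \<in> carrier G" for x y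
    using that commutator_in_derived carrier_U by simp
  have inv_comm: "inv\<^bsub>?U\<^esub> (commutator G x y) = commutator G y x"
    if "x \<in> carrier G" "y \<in> carrier G" for x y
  proof (rule U.inv_equality)
    show "commutator G y x \<otimes>\<^bsub>?U\<^esub> commutator G x y = \<one>\<^bsub>?U\<^esub>"
      using that by (simp add: mult_U one_U commutator_swap[of x y])
  qed (use that comm_U in auto)
  \<comment> \<open>Inverting the rule for the left argument reverses the two factors; centrality of
    commutators restores their order.\<close>
  have comm_right: "commutator G t (x \<otimes> y) = commutator G t x \<otimes> commutator G t y"
    if "x \<in> carrier G" "y \<in> carrier G" "t \<in> carrier G" for x y t
  proof -
    have "commutator G t (x \<otimes> y) = inv (commutator G x t \<otimes> commutator G y t)"
      using that comm_central commutator_mult_left commutator_swap[of "x \<otimes> y" t] by simp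
    also have "\<dots> = commutator G t y \<otimes> commutator G t x"
      using that by (simp add: inv_mult_group commutator_swap[of _ t])
    also have "\<dots> = commutator G t x \<otimes> commutator G t y"
      using that comm_central by (intro center_commute) auto
    finally show ?thesis .
  qed
  interpret Q: comm_group ?Q
  proof (rule Q.group_comm_groupI)
    fix R S assume "R \<in> carrier ?Q" "S \<in> carrier ?Q"
    then obtain x y where x: "x \<in> carrier G" "R = ?Z #> x" and y: "y \<in> carrier G" "S = ?Z #> y"
      by (auto simp: carrier_FactGroup)
    have "?Z #> (x \<otimes> y) = ?Z #> (y \<otimes> x)"
    proof (subst center_coset_eq_iff)
      show "\<exists>z \<in> center G. x \<otimes> y = z \<otimes> (y \<otimes> x)"
        using comm_central[OF x(1) y(1)] commutator_mult[OF x(1) y(1)] by (intro bexI) auto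
    qed (use x y in auto)
    then show "R \<otimes>\<^bsub>?Q\<^esub> S = S \<otimes>\<^bsub>?Q\<^esub> R"
      using x y by (simp add: Z.rcos_sum)
  qed
  interpret U: comm_group ?U
  proof (rule U.group_comm_groupI)
    fix u v assume u: "u \<in> carrier ?U" and v: "v \<in> carrier ?U"
    then have "u \<in> center G" "v \<in> carrier G"
      using class2 center_subset carrier_U by auto
    then show "u \<otimes>\<^bsub>?U\<^esub> v = v \<otimes>\<^bsub>?U\<^esub> u"
      unfolding mult_U by (rule center_commute)
  qed
  \<comment> \<open>As n is odd, k is an inverse of 2 modulo n; on the derived subgroup, whose
    elements have trivial n-th power, raising to the power k extracts square roots.\<close>
  define k where "k = (n + 1) div 2"
  have k: "k + k = Suc n"
    using odd unfolding k_def by presburger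
  define c where "c R S = coset_commutator G R S [^]\<^bsub>?U\<^esub> k" for R S
  have c_coset: "c (?Z #> x) (?Z #> y) = commutator G x y [^]\<^bsub>?U\<^esub> k"
    if "x \<in> carrier G" "y \<in> carrier G" for x y
    using coset_commutator_eq that by (simp add: c_def)
  \<comment> \<open>Because [y, x] is the inverse of [x, y], the left side is [x, y]^(2 k) =
    [x, y]^(n + 1) = [x, y]; the extension thus has the commutators of \<open>G\<close>.\<close>
  have c_diff: "c (?Z #> x) (?Z #> y) \<otimes>\<^bsub>?U\<^esub> inv\<^bsub>?U\<^esub> (c (?Z #> y) (?Z #> x)) = commutator G x y"
    if xy: "x \<in> carrier G" "y \<in> carrier G" for x y
  proof -
    let ?u = "commutator G x y"
    have u: "?u \<in> carrier ?U"
      by (rule comm_U[OF xy])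
    have "inv\<^bsub>?U\<^esub> (commutator G y x [^]\<^bsub>?U\<^esub> k) = inv\<^bsub>?U\<^esub> (commutator G y x) [^]\<^bsub>?U\<^esub> k"
      using U.nat_pow_inv[OF comm_U[OF xy(2,1)]] by simp
    also have "inv\<^bsub>?U\<^esub> (commutator G y x) = ?u"
      by (rule inv_comm[OF xy(2,1)])
    finally have "c (?Z #> x) (?Z #> y) \<otimes>\<^bsub>?U\<^esub> inv\<^bsub>?U\<^esub> (c (?Z #> y) (?Z #> x))
        = ?u [^]\<^bsub>?U\<^esub> k \<otimes>\<^bsub>?U\<^esub> ?u [^]\<^bsub>?U\<^esub> k"
      using c_coset xy by simp
    also have "\<dots> = ?u [^]\<^bsub>?U\<^esub> Suc n"
      using U.nat_pow_mult[OF u] k by simp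
    also have "\<dots> = ?u [^]\<^bsub>?U\<^esub> n \<otimes>\<^bsub>?U\<^esub> ?u"
      by simp
    also have "?u [^]\<^bsub>?U\<^esub> n = ?u [^] n"
      unfolding derived_group_def by (rule nat_pow_consistent[symmetric])
    also have "\<dots> = \<one>\<^bsub>?U\<^esub>"
      unfolding one_U using u carrier_U exponent by blast
    finally show ?thesis
      using u by simp
  qed
  interpret B: bilinear_pairing ?Q ?U c
  proof
    fix R S T assume "R \<in> carrier ?Q" "S \<in> carrier ?Q" "T \<in> carrier ?Q"
    then obtain x y t where x: "x \<in> carrier G" "R = ?Z #> x" and y: "y \<in> carrier G" "S = ?Z #> y"
      and t: "t \<in> carrier G" "T = ?Z #> t"
      by (auto simp: carrier_FactGroup)
    have RS: "R \<otimes>\<^bsub>?Q\<^esub> S = ?Z #> (x \<otimes> y)"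
      using x y by (simp add: Z.rcos_sum)
    have "commutator G (x \<otimes> y) t = commutator G x t \<otimes>\<^bsub>?U\<^esub> commutator G y t"
      unfolding mult_U using x y t comm_central by (intro commutator_mult_left) auto
    then show "c (R \<otimes>\<^bsub>?Q\<^esub> S) T = c R T \<otimes>\<^bsub>?U\<^esub> c S T"
      unfolding RS unfolding x(2) y(2) t(2) using x(1) y(1) t(1) comm_U
      by (simp add: c_coset U.nat_pow_distrib)
    have "commutator G t (x \<otimes> y) = commutator G t x \<otimes>\<^bsub>?U\<^esub> commutator G t y"
      unfolding mult_U using x y t by (intro comm_right)
    then show "c T (R \<otimes>\<^bsub>?Q\<^esub> S) = c T R \<otimes>\<^bsub>?U\<^esub> c T S"
      unfolding RS unfolding x(2) y(2) t(2) using x(1) y(1) t(1) comm_U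
      by (simp add: c_coset U.nat_pow_distrib)
  next
    fix R S assume "R \<in> carrier ?Q" "S \<in> carrier ?Q"
    then obtain x y where x: "x \<in> carrier G" "R = ?Z #> x" and y: "y \<in> carrier G" "S = ?Z #> y"
      by (auto simp: carrier_FactGroup)
    then show "c R S \<in> carrier ?U"
      using comm_U by (simp add: c_coset)
  qed
  \<comment> \<open>Products of values of \<open>?f\<close> pick up \<open>c\<close> in the second
    component; this error is central, as \<open>isoclinism_map\<close> permits. In
    \<open>?\<phi>\<close> the coset \<open>?Z\<close> is the identity of the quotient.\<close>
  let ?f = "\<lambda>x. (?Z #> x, \<one>)" and ?\<phi> = "\<lambda>u. (?Z, u)"
  have one_Q: "\<one>\<^bsub>?Q\<^esub> = ?Z" by simp
  have coset: "?Z #> x \<in> carrier ?Q" if "x \<in> carrier G" for x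
    using that by (auto simp: carrier_FactGroup)
  have oneU: "\<one> \<in> carrier ?U"
    using U.one_closed one_U by simp
  have "isoclinism_map G B.K ?f ?\<phi>"
    unfolding isoclinism_map_def
  proof (intro conjI ballI)
    show "?f \<in> carrier G \<rightarrow> carrier B.K"
      using coset oneU by (auto simp: B.carrier_K)
    show "\<exists>z \<in> center B.K. ?f (x \<otimes> y) = z \<otimes>\<^bsub>B.K\<^esub> (?f x \<otimes>\<^bsub>B.K\<^esub> ?f y)"
      if xy: "x \<in> carrier G" "y \<in> carrier G" for x y
    proof -
      let ?w = "c (?Z #> x) (?Z #> y)"
      have w: "?w \<in> carrier ?U"
        using xy coset B.closed by blast
      have "?f x \<otimes>\<^bsub>B.K\<^esub> ?f y = (?Z #> (x \<otimes> y), ?w)"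
        using xy w oneU U.l_one unfolding B.mult_K by (simp add: Z.rcos_sum one_U[symmetric])
      then have "?f (x \<otimes> y) = (\<one>\<^bsub>?Q\<^esub>, inv\<^bsub>?U\<^esub> ?w) \<otimes>\<^bsub>B.K\<^esub> (?f x \<otimes>\<^bsub>B.K\<^esub> ?f y)"
        using w xy coset B.central_mult[of "inv\<^bsub>?U\<^esub> ?w" "?Z #> (x \<otimes> y)" ?w] by (simp add: one_U)
      then show ?thesis
        using B.in_center w by blast
    qed
    show "\<exists>x \<in> carrier G. \<exists>z \<in> center B.K. l = z \<otimes>\<^bsub>B.K\<^esub> ?f x" if l: "l \<in> carrier B.K" for l
    proof -
      obtain x u where x: "x \<in> carrier G" "u \<in> carrier ?U" "l = (?Z #> x, u)"
        using l by (auto simp: B.carrier_K carrier_FactGroup)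
      have "l = (\<one>\<^bsub>?Q\<^esub>, u) \<otimes>\<^bsub>B.K\<^esub> ?f x"
        using x coset oneU B.central_mult[of u "?Z #> x" "\<one>"] U.r_one by (simp add: one_U)
      then show ?thesis
        using x B.in_center by blast
    qed
    show "?\<phi> \<in> hom ?U B.K"
    proof (rule homI)
      show "?\<phi> u \<in> carrier B.K" if "u \<in> carrier ?U" for u
        using that Q.one_closed by (simp add: B.carrier_K)
      show "?\<phi> (u \<otimes>\<^bsub>?U\<^esub> v) = ?\<phi> u \<otimes>\<^bsub>B.K\<^esub> ?\<phi> v" if "u \<in> carrier ?U" "v \<in> carrier ?U" for u v
        using that B.central_mult[of u "\<one>\<^bsub>?Q\<^esub>" v] Q.one_closed by simp
    qed
    show "inj_on ?\<phi> (derived G (carrier G))"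
      by (simp add: inj_on_def)
    show "?\<phi> (commutator G x y) = commutator B.K (?f x) (?f y)"
      if "x \<in> carrier G" "y \<in> carrier G" for x y
      using that coset oneU by (simp add: B.commutator_K c_diff)
  qed
  moreover have "order B.K = card (rcosets ?Z) * card (derived G (carrier G))"
    by (simp add: order_def B.carrier_K carrier_Q carrier_U card_cartesian_product)
  ultimately show ?thesis
    using B.group_K by blast
qed

section \<open>Families of rank four\<close>

text \<open>In class two the commutator with \<open>g\<close> is a homomorphism, and this set is the
  preimage of \<open>I\<close>. Membership of commutators in \<open>I\<close> can thus be tested on
  generators.\<close>

lemma (in group) subgroup_commutator_left:
  assumes class2: "\<And>x y. x \<in> carrier G \<Longrightarrow> y \<in> carrier G \<Longrightarrow> commutator G x y \<in> center G"
    and I: "subgroup I G" and g: "g \<in> carrier G"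
  shows "subgroup {h \<in> carrier G. commutator G h g \<in> I} G"
proof (rule subgroupI)
  have mult: "commutator G (a \<otimes> b) g = commutator G a g \<otimes> commutator G b g"
    if "a \<in> carrier G" "b \<in> carrier G" for a b
    using that g class2 by (intro commutator_mult_left) auto
  have one: "commutator G \<one> g = \<one>"
    using g commutator_eq_one_iff[of \<one> g] by simp
  have inv: "commutator G (inv a) g = inv (commutator G a g)" if a: "a \<in> carrier G" for a
  proof (rule inv_equality[symmetric])
    show "commutator G (inv a) g \<otimes> commutator G a g = \<one>"
      using mult[of "inv a" a] a one by simp
  qed (use a g in auto)
  show "{h \<in> carrier G. commutator G h g \<in> I} \<noteq> {}"
    using one subgroup.one_closed[OF I] by auto
  show "inv a \<in> {h \<in> carrier G. commutator G h g \<in> I}" if "a \<in> {h \<in> carrier G. commutator G h g \<in> I}" for a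
    using that inv subgroup.m_inv_closed[OF I] by simp
  show "a \<otimes> b \<in> {h \<in> carrier G. commutator G h g \<in> I}"
    if "a \<in> {h \<in> carrier G. commutator G h g \<in> I}" "b \<in> {h \<in> carrier G. commutator G h g \<in> I}" for a b
    using that mult subgroup.m_closed[OF I] by simp
qed auto

context prime_power_group
begin

lemma maximal_subgroup_eq:
  assumes A: "subgroup A G" "order G = p * card A" and S: "subgroup S G" "A \<subseteq> S" "y \<in> S" "y \<notin> A"
  shows "S = carrier G"
proof -
  have "p * card A dvd card S"
    using card_psubset_subgroup[OF A(1) S(1)] S by blast
  moreover have "card S > 0"
    using finite_subgroup[OF S(1)] S(3) card_gt_0_iff by blast
  ultimately have "card (carrier G) \<le> card S"
    using A(2) dvd_imp_le unfolding order_def by metis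
  then show ?thesis
    using subgroup.subset[OF S(1)] finite_carrier by (intro card_seteq)
qed

text \<open>The central quotient is a p-group of order at most p^2. If nontrivial, it has a
  nontrivial center, of index at most p, so it is abelian and commutators of \<open>G\<close> fall
  into Z.\<close>

lemma commutator_central_of_index_le:
  assumes "order G \<le> p ^ 2 * card (center G)" "x \<in> carrier G" "y \<in> carrier G"
  shows "commutator G x y \<in> center G"
proof -
  interpret Z: normal "center G" G by (rule normal_center)
  obtain i where i: "card (center G) = p ^ i"
    using card_subgroup[OF subgroup_center] by blast
  have "card (rcosets (center G)) dvd p ^ m"
    using lagrange[OF subgroup_center] order_eq by (metis dvd_triv_left)
  then obtain j where j: "order (G Mod center G) = p ^ j"
    using divides_primepow_nat[OF prime_p] by (auto simp: order_def FactGroup_def)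
  interpret Q: prime_power_group "G Mod center G" p j
    by (intro prime_power_group.intro Z.factorgroup_is_group prime_power_group_axioms.intro prime_p j)
  have "p ^ j * card (center G) \<le> p ^ 2 * card (center G)"
    using lagrange[OF subgroup_center] j assms(1) by (simp add: order_def FactGroup_def)
  moreover have "card (center G) > 0"
    using i p_pos by simp
  ultimately have "p ^ j \<le> p ^ 2"
    by simp
  have "order (G Mod center G) \<le> p * card (center (G Mod center G))"
  proof (cases "j = 0")
    \<comment> \<open>The center of the trivial quotient has order 1, which p does not divide; the
      bound is just 1 \<le> p.\<close>
    case True
    then show ?thesis
      using j p_pos Q.finite_subgroup[OF Q.subgroup_center] subgroup.one_closed[OF Q.subgroup_center]
      by (simp add: Suc_le_eq card_gt_0_iff) blast
  next
    case False
    then have "p dvd card (center (G Mod center G))"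
      using Q.p_dvd_card_center by simp
    moreover have "card (center (G Mod center G)) > 0"
      using Q.finite_subgroup[OF Q.subgroup_center] subgroup.one_closed[OF Q.subgroup_center]
        card_gt_0_iff by blast
    ultimately have "p ^ 2 \<le> p * card (center (G Mod center G))"
      using dvd_imp_le unfolding power2_eq_square by simp
    then show ?thesis
      using j \<open>p ^ j \<le> p ^ 2\<close> by linarith
  qed
  then have "center (G Mod center G) = carrier (G Mod center G)"
    by (rule Q.center_eq_carrier)
  moreover have "center G #> x \<in> carrier (G Mod center G)" "center G #> y \<in> carrier (G Mod center G)"
    using assms by (auto simp: carrier_FactGroup)
  ultimately have "(center G #> x) <#> (center G #> y) = (center G #> y) <#> (center G #> x)"
    using Q.center_commute[of "center G #> x" "center G #> y"] by simp
  then have "center G #> (x \<otimes> y) = center G #> (y \<otimes> x)"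
    using assms by (simp add: Z.rcos_sum)
  then obtain z where z: "z \<in> center G" "x \<otimes> y = z \<otimes> (y \<otimes> x)"
    using center_coset_eq_iff assms by auto
  then have "commutator G x y = z"
    using assms center_subset by (intro commutator_unique) auto
  then show ?thesis
    using z by simp
qed

lemma derived_subset_center_of_index_le:
  assumes "order G \<le> p ^ 2 * card (center G)"
  shows "derived G (carrier G) \<subseteq> center G"
  unfolding derived_eq_generate using commutator_central_of_index_le[OF assms] subgroup_center
  by (intro generate_subgroup_incl) auto

text \<open>A nonabelian \<open>G\<close> has an abelian subgroup \<open>?A\<close> of index p and
  is generated by it with any \<open>y\<close> outside. Every commutator is then some [a, y] with a
  in \<open>?A\<close>, and this depends only on the coset of a modulo Z, one of p cosets.\<close>

lemma card_derived_le:
  assumes index: "order G \<le> p ^ 2 * card (center G)"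
  shows "card (derived G (carrier G)) \<le> p"
proof (cases "center G = carrier G")
  case True
  have "{commutator G x y |x y. x \<in> carrier G \<and> y \<in> carrier G} \<subseteq> {\<one>}"
    using True commutator_eq_one_of_center by auto
  then have "derived G (carrier G) \<subseteq> {\<one>}"
    unfolding derived_eq_generate using triv_subgroup by (intro generate_subgroup_incl)
  then have "card (derived G (carrier G)) \<le> card {\<one>}"
    by (intro card_mono) auto
  then show ?thesis
    using p_pos by simp
next
  case False
  then obtain x where x: "x \<in> carrier G - center G"
    using center_subset by blast
  let ?A = "centralizer G x" and ?z = "card (center G)"
  have A: "subgroup ?A G"
    using x subgroup_centralizer by blast
  have "p * ?z dvd card ?A" "p * card ?A dvd order G"
    using card_psubset_subgroup subgroup_center subgroup_self A centralizer_psubset[OF x]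
    unfolding order_def by blast+
  moreover have "order G > 0" "card ?A > 0"
    using finite_carrier order_gt_0_iff_finite finite_subgroup[OF A] subgroup.one_closed[OF A]
      card_gt_0_iff by blast+
  ultimately have lower: "p * ?z \<le> card ?A" and upper: "p * card ?A \<le> order G"
    using dvd_imp_le by blast+
  \<comment> \<open>Z, \<open>?A\<close> and \<open>G\<close> form a chain with two proper steps,
    each of index at least p, and total index at most p^2; both indices are therefore p.\<close>
  have "p * card ?A \<le> p * (p * ?z)"
    using le_trans[OF upper index] by (simp only: power2_eq_square mult.assoc)
  then have cA: "card ?A = p * ?z"
    using lower p_pos by simp
  have ord: "order G = p * card ?A"
    using index upper unfolding cA by (simp add: power2_eq_square mult.assoc)
  have sub: "center G \<subseteq> ?A"
    using x center_subset_centralizer by blast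
  have A_comm: "u \<otimes> v = v \<otimes> u" if uv: "u \<in> ?A" "v \<in> ?A" for u v
  proof (rule commute_of_central_index_le[OF subgroup_center A sub _ _ uv])
    show "d \<otimes> s = s \<otimes> d" if "d \<in> center G" "s \<in> ?A" for d s
      using that(1) subsetD[OF centralizer_subset that(2)] by (rule center_commute)
  qed (simp add: cA)
  obtain y where y: "y \<in> carrier G" "y \<notin> ?A"
    using centralizer_psubset(2)[OF x] by blast
  have AG: "a \<in> carrier G" if "a \<in> ?A" for a
    using that centralizer_subset by blast
  have central: "commutator G g h \<in> center G" if "g \<in> carrier G" "h \<in> carrier G" for g h
    using commutator_central_of_index_le[OF index that] .
  define I where "I = (\<lambda>a. commutator G a y) ` ?A"
  have comm_y_mult: "commutator G (a \<otimes> b) y = commutator G a y \<otimes> commutator G b y"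
    if "a \<in> ?A" "b \<in> ?A" for a b
    using that AG y central by (intro commutator_mult_left) auto
  have one_y: "commutator G \<one> y = \<one>"
    using y commutator_eq_one_iff[of \<one> y] by simp
  have I: "subgroup I G"
  proof (rule subgroupI)
    show "I \<subseteq> carrier G"
      using AG y by (auto simp: I_def)
    show "I \<noteq> {}"
      using subgroup.one_closed[OF A] by (auto simp: I_def)
    show "inv u \<in> I" if u: "u \<in> I" for u
    proof -
      obtain a where a: "a \<in> ?A" "u = commutator G a y"
        using u by (auto simp: I_def)
      have ia: "inv a \<in> ?A"
        using subgroup.m_inv_closed[OF A a(1)] .
      have "commutator G (inv a) y \<otimes> u = \<one>"
        using comm_y_mult[OF ia a(1)] AG[OF a(1)] one_y unfolding a(2) by simp
      then have "inv u = commutator G (inv a) y"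
        using AG[OF a(1)] y(1) unfolding a(2) by (intro inv_equality) simp_all
      then show ?thesis
        using ia by (simp add: I_def)
    qed
    show "u \<otimes> v \<in> I" if u: "u \<in> I" and v: "v \<in> I" for u v
    proof -
      obtain a b where a: "a \<in> ?A" "u = commutator G a y" and b: "b \<in> ?A" "v = commutator G b y"
        using u v by (auto simp: I_def)
      show ?thesis
        unfolding a(2) b(2) comm_y_mult[OF a(1) b(1), symmetric] I_def
        using subgroup.m_closed[OF A a(1) b(1)] by (rule imageI)
    qed
  qed
  have oneI: "\<one> \<in> I"
    using subgroup.one_closed[OF I] .
  have swap: "commutator G g h \<in> I" if "commutator G h g \<in> I" "g \<in> carrier G" "h \<in> carrier G" for g h
    using that commutator_swap[of h g] subgroup.m_inv_closed[OF I] by simp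
  \<comment> \<open>For fixed \<open>g\<close>, the \<open>h\<close> with [h, g] in \<open>I\<close>
    form a subgroup, and one containing \<open>?A\<close> and \<open>y\<close> is everything because
    \<open>?A\<close> is maximal. It is used for \<open>g\<close> in \<open>?A\<close>, for
    \<open>g = y\<close>, and then for arbitrary \<open>g\<close>.\<close>
  have everything: "commutator G h g \<in> I"
    if "g \<in> carrier G" "h \<in> carrier G" "\<And>a. a \<in> ?A \<Longrightarrow> commutator G a g \<in> I" "commutator G y g \<in> I" for g h
  proof -
    have "subgroup {h \<in> carrier G. commutator G h g \<in> I} G"
      using subgroup_commutator_left[OF central I that(1)] .
    then have "{h \<in> carrier G. commutator G h g \<in> I} = carrier G"
      by (rule maximal_subgroup_eq[OF A ord]) (use that y AG in auto)
    then show ?thesis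
      using that(2) by blast
  qed
  have a_any: "commutator G h a \<in> I" if a: "a \<in> ?A" and h: "h \<in> carrier G" for a h
  proof (rule everything[OF AG[OF a] h])
    show "commutator G b a \<in> I" if "b \<in> ?A" for b
      using commutator_eq_one_iff[OF AG[OF that] AG[OF a]] A_comm[OF that a] oneI by simp
    show "commutator G y a \<in> I"
      by (rule swap) (use a AG y in \<open>auto simp: I_def\<close>)
  qed
  have y_any: "commutator G h y \<in> I" if h: "h \<in> carrier G" for h
  proof (rule everything[OF y(1) h])
    show "commutator G a y \<in> I" if "a \<in> ?A" for a
      using that by (auto simp: I_def)
    show "commutator G y y \<in> I"
      using commutator_eq_one_iff[OF y(1) y(1)] oneI by simp
  qed
  have "commutator G h g \<in> I" if g: "g \<in> carrier G" and h: "h \<in> carrier G" for g h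
  proof (rule everything[OF g h])
    show "commutator G a g \<in> I" if "a \<in> ?A" for a
      using a_any[OF that g] swap AG[OF that] g by blast
    show "commutator G y g \<in> I"
      using y_any[OF g] swap y g by blast
  qed
  then have "derived G (carrier G) \<subseteq> I"
    unfolding derived_eq_generate using I by (intro generate_subgroup_incl) auto
  moreover have "finite I"
    using finite_subgroup[OF I] .
  ultimately have "card (derived G (carrier G)) \<le> card I"
    by (intro card_mono)
  \<comment> \<open>Viewing \<open>I\<close> as an image of cosets improves the bound from the order
    of \<open>?A\<close> to its index p over Z.\<close>
  also have "I = (\<lambda>R. coset_commutator G R (center G #> y)) ` (\<lambda>a. center G #> a) ` ?A"
    unfolding I_def image_image using coset_commutator_eq AG y by (intro image_cong) auto
  also have "card \<dots> \<le> card ((\<lambda>a. center G #> a) ` ?A)"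
    using finite_subgroup[OF A] by (intro card_image_le) auto
  also have "\<dots> = p"
  proof -
    have "card ((\<lambda>a. center G #> a) ` ?A) * ?z = p * ?z"
      using card_image_cosets[OF subgroup_center A] x center_subset_centralizer cA by simp
    moreover have "?z > 0"
      using cA \<open>card ?A > 0\<close> by (cases ?z) auto
    ultimately show ?thesis by simp
  qed
  finally show ?thesis .
qed

text \<open>The extension has order |G/Z| |G'|, at most p^2 p. As |G'| is 1 or p, the odd number p
  serves as the exponent needed for halving.\<close>

lemma family_rank_le_three:
  assumes "odd p" and index: "order G \<le> p ^ 2 * card (center G)"
  shows "family_rank p G \<le> 3"
proof -
  let ?D = "derived G (carrier G)"
  have D: "subgroup ?D G"
    using derived_is_subgroup by blast
  obtain j where j: "card ?D = p ^ j"
    using card_subgroup[OF D] by blast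
  have "p ^ j \<le> p ^ 1"
    using card_derived_le[OF index] j by simp
  then have j1: "j \<le> 1"
    using p_gt_1 power_le_imp_le_exp by blast
  have "u [^] p = \<one>" if u: "u \<in> ?D" for u
  proof -
    interpret D: group "G\<lparr>carrier := ?D\<rparr>"
      using D by (rule subgroup_imp_group)
    have "u [^]\<^bsub>G\<lparr>carrier := ?D\<rparr>\<^esub> order (G\<lparr>carrier := ?D\<rparr>) = \<one>"
      using D.pow_order_eq_1[of u] u by simp
    then have "u [^] (p ^ j) = \<one>"
      by (simp add: nat_pow_consistent[symmetric] order_def j)
    moreover have "u \<in> carrier G"
      using u subgroup.subset[OF D] by blast
    ultimately show ?thesis
      using j1 by (cases j) auto
  qed
  from exists_stem_of_class_two[OF derived_subset_center_of_index_le[OF index] assms(1) this]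
  obtain K :: "('a set \<times> 'a) monoid" and f \<phi> where
    K: "group K" "order K = card (rcosets (center G)) * card ?D" "isoclinism_map G K f \<phi>"
    by blast
  have "card (rcosets (center G)) dvd p ^ m"
    using lagrange[OF subgroup_center] order_eq by (metis dvd_triv_left)
  then obtain i where i: "card (rcosets (center G)) = p ^ i"
    using divides_primepow_nat[OF prime_p] by auto
  have "p ^ i * card (center G) \<le> p ^ 2 * card (center G)"
    using lagrange[OF subgroup_center] index i by simp
  moreover have "card (center G) > 0"
    using finite_subgroup[OF subgroup_center] subgroup.one_closed[OF subgroup_center]
      card_gt_0_iff by blast
  ultimately have "i \<le> 2"
    using p_gt_1 power_le_imp_le_exp by simp
  have "order K = p ^ (i + j)"
    using K i j by (simp add: power_add)
  then have "family_rank p G \<le> i + j"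
    using family_rank_le[OF is_group K(1,3)] p_pos by blast
  then show ?thesis
    using j1 \<open>i \<le> 2\<close> by simp
qed

text \<open>The central quotients of \<open>G\<close> and \<open>H\<close> have the same order p^(4
  - i), where |Z(H)| = p^i. The bound of three on the rank excludes i \<ge> 2, and p-groups of
  positive exponent exclude i = 0; so i = 1.\<close>

lemma large_centralizer_of_rank_four:
  assumes "odd p" and "family_rank p G = 4"
  shows "\<exists>x. large_centralizer G p m x"
proof -
  obtain H :: "nat monoid" where H: "group H" "order H = p ^ 4" "isoclinic G H"
    using family_rank_attained assms(2) by auto
  interpret H: prime_power_group H p 4
    by (intro prime_power_group.intro H prime_power_group_axioms.intro prime_p)
  have rcos: "card (rcosets (center G)) = card (rcosets\<^bsub>H\<^esub> (center H))"
    using isoclinic_card_eqs(1)[OF is_group H(1,3)] .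
  obtain i where i: "i \<le> 4" "card (center H) = p ^ i"
    using H.card_subgroup[OF H.subgroup_center] by blast
  have "p dvd p ^ i"
    using H.p_dvd_card_center i(2) by simp
  then have "i \<noteq> 0"
    using p_gt_1 by (intro notI) simp
  have "card (rcosets\<^bsub>H\<^esub> (center H)) * p ^ i = p ^ (4 - i) * p ^ i"
    using H.lagrange[OF H.subgroup_center] i H(2) by (simp flip: power_add)
  then have "card (rcosets (center G)) = p ^ (4 - i)"
    using rcos p_pos by simp
  then have ord: "order G = p ^ (4 - i) * card (center G)"
    using lagrange[OF subgroup_center] by simp
  have "i = 1"
  proof (rule ccontr)
    assume "i \<noteq> 1"
    then have "4 - i \<le> 2"
      using \<open>i \<noteq> 0\<close> by simp
    then have "p ^ (4 - i) \<le> p ^ 2"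
      using p_pos by (intro power_increasing) auto
    then have "order G \<le> p ^ 2 * card (center G)"
      unfolding ord by (rule mult_le_mono1)
    then show False
      using family_rank_le_three assms by simp
  qed
  then have zH: "card (center H) = p"
    using i by simp
  obtain h where h: "h \<in> carrier H" "card (centralizer H h) = p ^ 3"
    using H.exists_large_centralizer zH by blast
  obtain x where x: "x \<in> carrier G" "card (centralizer G x) * p = p ^ 3 * card (center G)"
    using isoclinic_card_eqs(2)[OF is_group H(1,3) h(1)] unfolding zH h(2) by blast
  have ord3: "order G = p ^ 3 * card (center G)"
    using ord \<open>i = 1\<close> by simp
  then have ordC: "order G = p * card (centralizer G x)"
    using x by (simp add: mult.commute)
  \<comment> \<open>Noncentrality is read off from the index: the centralizer of a central element
    has index 1 instead of p.\<close>
  have "x \<notin> center G"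
  proof
    assume "x \<in> center G"
    then have "order G = p * order G"
      using ordC center_iff_centralizer[OF x(1)] by (simp add: order_def)
    then show False
      using order_eq p_gt_1 by simp
  qed
  then have "large_centralizer G p m x"
    using x ord3 ordC by unfold_locales auto
  then show ?thesis
    by blast
qed

end

text \<open>Substituting t/|G| divides the n-th coefficient by |G|^n, the factor isolated in
  \<open>alpha_eq\<close> and \<open>beta_eq\<close>; what remains is a sum of n-th coefficients of
  geometric series.\<close>

theorem lemma5p2:
  fixes G :: "('a, 'b) monoid_scheme" and p m :: nat and q :: rat
  defines "q \<equiv> of_nat p"
  assumes "prime p" and "odd p"
    and "group G" and "order G = p ^ m" and "family_rank p G = 4"
  shows "A_series G oo (fps_const (1 / of_nat (order G)) * fps_X) =
           geom (1 - 1/q) (1/q^2) + geom (1/q - 1/q^3) (1/q) + geom (1/q^3) 1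
       \<and> B_series G oo (fps_const (1 / of_nat (order G)) * fps_X) =
           geom (- 1/q) (1/q^3) + geom 1 (1/q^2) + geom (1/q) (1/q)"
proof -
  interpret prime_power_group G p m
    using assms by (intro prime_power_group.intro prime_power_group_axioms.intro)
  obtain x where "large_centralizer G p m x"
    using large_centralizer_of_rank_four assms by blast
  then interpret large_centralizer G p m x .
  have q: "q \<noteq> 0"
    using p_pos by (simp add: q_def)
  have N: "(of_nat (order G) :: rat) ^ n \<noteq> 0" for n
    using finite_carrier order_gt_0_iff_finite by simp
  have "fps_nth (A_series G oo (fps_const (1 / of_nat (order G)) * fps_X)) n =
      fps_nth (geom (1 - 1/q) (1/q^2) + geom (1/q - 1/q^3) (1/q) + geom (1/q^3) 1) n" for n
  proof -
    have "of_nat (alpha G n) = (of_nat (order G) :: rat) ^ n *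
        (1 + (q ^ 2 - 1) / q ^ n + (q ^ 3 - q ^ 2) / (q ^ 2) ^ n) / q ^ 3"
      using alpha_eq[of n] q by (simp add: q_def field_simps)
    then have "of_nat (alpha G n) / of_nat (order G) ^ n =
        (1 + (q ^ 2 - 1) / q ^ n + (q ^ 3 - q ^ 2) / (q ^ 2) ^ n) / q ^ 3"
      using N[of n] by simp
    \<comment> \<open>Division by q^3 turns the class sizes 1, q^2 - 1 and q^3 - q^2, counted in
      units of z, into the proportions 1/q^3, 1/q - 1/q^3 and 1 - 1/q.\<close>
    also have "\<dots> = (1 - 1/q) * (1/q^2) ^ n + (1/q - 1/q^3) * (1/q) ^ n + 1/q^3"
      using q by (simp add: field_simps power2_eq_square power3_eq_cube)
    finally have "of_nat (alpha G n) / of_nat (order G) ^ n =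
        (1 - 1/q) * (1/q^2) ^ n + (1/q - 1/q^3) * (1/q) ^ n + 1/q^3" .
    moreover have "fps_nth (A_series G oo (fps_const (1 / of_nat (order G)) * fps_X)) n =
        of_nat (alpha G n) / of_nat (order G) ^ n"
      by (simp add: A_series_def power_one_over)
    ultimately show ?thesis
      by (simp add: geom_nth)
  qed
  moreover have "fps_nth (B_series G oo (fps_const (1 / of_nat (order G)) * fps_X)) n =
      fps_nth (geom (- 1/q) (1/q^3) + geom 1 (1/q^2) + geom (1/q) (1/q)) n" for n
  proof -
    have "of_nat (beta G n) = (of_nat (order G) :: rat) ^ n *
        (1 / q ^ n + q / (q ^ 2) ^ n - 1 / (q ^ 3) ^ n) / q"
      using beta_eq[of n] q by (simp add: q_def field_simps)
    then have "of_nat (beta G n) / of_nat (order G) ^ n =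
        (1 / q ^ n + q / (q ^ 2) ^ n - 1 / (q ^ 3) ^ n) / q"
      using N[of n] by simp
    also have "\<dots> = (- 1/q) * (1/q^3) ^ n + 1 * (1/q^2) ^ n + (1/q) * (1/q) ^ n"
      using q by (simp add: field_simps)
    finally have "of_nat (beta G n) / of_nat (order G) ^ n =
        (- 1/q) * (1/q^3) ^ n + 1 * (1/q^2) ^ n + (1/q) * (1/q) ^ n" .
    moreover have "fps_nth (B_series G oo (fps_const (1 / of_nat (order G)) * fps_X)) n =
        of_nat (beta G n) / of_nat (order G) ^ n"
      by (simp add: B_series_def power_one_over)
    ultimately show ?thesis
      by (simp add: geom_nth)
  qed
  ultimately show ?thesis
    by (simp add: fps_eq_iff)
qed

end
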